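(* Let $(z,\tau)\in \mathbb{C}^g\times\mathcal{H}_g$ be a reduced point and $h\in \mathbb{Z}_{\geq 1}$. Let $\eta_{g,h}\in \mathbb{R}_{>0}$ be such that $\log(1/\eta_{g,h}) = 2^{25(1+\log^2 g)}h^2 \log(1+h)$, and let $D$ be any power of $2$ such that $D\geq 2^{20(1+\log^2 g)}(2^{2g} + 2^{g+h})$. Then at least half of the vectors $t\in \{0, \tfrac 1D,\ldots,\tfrac{D-1}{D}\}^g$ satisfy all of the following inequalities, where $v=-\operatorname{Im}(\tau)^{-1}\operatorname{Im}(z)$: for all $1\leq j\leq h-1$ and all $a\in\{0,1\}^g$, \begin{align*} |\theta_{a,0}(2^j t,2^j{\tau})| &\geq \eta_{g,h} \exp(-2^j \mathrm{Dist}_{\tau}(0, \mathbb{Z}^g + \tfrac a2)^2),\\ |\theta_{a,0}(2^{j+1}t ,2^j{\tau})| &\geq \eta_{g,h} \exp(-2^j \mathrm{Dist}_{\tau}(0, \mathbb{Z}^g + \tfrac a2)^2),\\ |\widetilde{\theta}_{a,0}(2^j(z + t),2^j{\tau})| &\geq \eta_{g,h} \exp(-2^j \mathrm{Dist}_{\tau}(v, \mathbb{Z}^g + \tfrac a2)^2),\\ |\widetilde{\theta}_{a,0}(2^j(z + 2t),2^j{\tau})| &\geq \eta_{g,h} \exp(-2^j \mathrm{Dist}_{\tau}(v, \mathbb{Z}^g + \tfrac a2)^2), \end{align*} and for all $a,b\in\{0,1\}^g$, \[|\widetilde{\theta}_{a,b}(z + 2t, {\tau})| \geq \eta_{g,h}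 \exp(- \mathrm{Dist}_{\tau}(v, \mathbb{Z}^g + \tfrac a2)^2).\]
   Context: $\mathcal{H}_g$: symmetric complex $g\times g$ matrices with positive definite imaginary part. $\mathrm{e}(x)=\exp(\pi ix)$; $\theta_{a,b}(z,\tau)=\sum_{n\in\mathbb{Z}^g+\frac a2}\mathrm{e}(n^T\tau n+2n^T(z+\tfrac b2))$ for $a,b\in\{0,1\}^g$; with $y=\operatorname{Im} z$, $Y=\operatorname{Im}\tau$, $\widetilde\theta_{a,b}(z,\tau)=\exp(-\pi y^TY^{-1}y)\theta_{a,b}(z,\tau)$. For $x\in\mathbb{R}^g$, $\|x\|_\tau=\sqrt{\pi x^TYx}$ and $\mathrm{Dist}_\tau$ is the associated distance. $\tau$ is reduced if $\operatorname{Im}(\tau)$ is reciprocal-HKZ reduced (the Gram matrix $P\operatorname{Im}(\tau)^{-1}P$, $P$ the coordinate-reversing permutation matrix, is Hermite–Korkine–Zolotarev reduced) and $n^T\operatorname{Im}(\tau)n\ge\sqrt3/2$ for all nonzero $n\in\mathbb{Z}^g$; $(z,\tau)$ is reduced if moreover $\|{-Y^{-1}y}\|_\infty\le 1$. *)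

theory Defs
  imports "HOL-Analysis.Analysis"
begin

(* The genus g is CARD('g).  Where the order of the coordinates 1, ..., g matters, 'g is in
   addition of class linorder; a finite linear order is the same thing as {1 < ... < g}. *)

definition int_vecs :: "(real ^ 'g) set" where
  "int_vecs = {n. \<forall>i. n $ i \<in> \<int>}"

definition char_vecs :: "(real ^ 'g) set" where
  "char_vecs = {a. \<forall>i. a $ i \<in> {0, 1}}"

definition half_shift :: "real ^ 'g \<Rightarrow> (real ^ 'g) set" where
  "half_shift a = (\<lambda>n. n + (1/2) *\<^sub>R a) ` int_vecs"

definition cvec :: "real ^ 'g \<Rightarrow> complex ^ 'g" where
  "cvec x = (\<chi> i. complex_of_real (x $ i))"

definition Im_vec :: "complex ^ 'g \<Rightarrow> real ^ 'g" where
  "Im_vec z = (\<chi> i. Im (z $ i))"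

definition Im_mat :: "complex ^ 'g ^ 'g \<Rightarrow> real ^ 'g ^ 'g" where
  "Im_mat \<tau> = (\<chi> i j. Im (\<tau> $ i $ j))"

(* x^T y without complex conjugation; the library's inner product on complex vectors is
   real-valued and cannot be used here. *)
definition cdot :: "complex ^ 'g \<Rightarrow> complex ^ 'g \<Rightarrow> complex" where
  "cdot x y = (\<Sum>i\<in>UNIV. x $ i * y $ i)"

definition siegel :: "(complex ^ 'g ^ 'g) set" where
  "siegel = {\<tau>. transpose \<tau> = \<tau> \<and> (\<forall>x. x \<noteq> 0 \<longrightarrow> x \<bullet> (Im_mat \<tau> *v x) > 0)}"

(* Normalised with pi, not 2 pi. *)
definition e_pi :: "complex \<Rightarrow> complex" where
  "e_pi x = exp (complex_of_real pi * \<i> * x)"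

definition theta ::
  "real ^ 'g \<Rightarrow> real ^ 'g \<Rightarrow> complex ^ 'g \<Rightarrow> complex ^ 'g ^ 'g \<Rightarrow> complex" where
  "theta a b z \<tau> =
     (\<Sum>\<^sub>\<infinity>n\<in>half_shift a.
        e_pi (cdot (cvec n) (\<tau> *v cvec n) + 2 * cdot (cvec n) (z + cvec ((1/2) *\<^sub>R b))))"

definition theta_tilde ::
  "real ^ 'g \<Rightarrow> real ^ 'g \<Rightarrow> complex ^ 'g \<Rightarrow> complex ^ 'g ^ 'g \<Rightarrow> complex" where
  "theta_tilde a b z \<tau> =
     complex_of_real (exp (- pi * (Im_vec z \<bullet> (matrix_inv (Im_mat \<tau>) *v Im_vec z)))) *
     theta a b z \<tau>"

definition norm_tau :: "complex ^ 'g ^ 'g \<Rightarrow> real ^ 'g \<Rightarrow> real" where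
  "norm_tau \<tau> x = sqrt (pi * (x \<bullet> (Im_mat \<tau> *v x)))"

definition dist_tau :: "complex ^ 'g ^ 'g \<Rightarrow> real ^ 'g \<Rightarrow> (real ^ 'g) set \<Rightarrow> real" where
  "dist_tau \<tau> x S = (INF s\<in>S. norm_tau \<tau> (x - s))"

(* The projection of x onto the orthogonal complement of the span of the basis vectors
   preceding b i; the closest point of a subspace is the orthogonal projection onto it.
   In particular gs_proj b i (b i) is the i-th Gram-Schmidt vector. *)
definition gs_proj :: "('g::{finite,linorder} \<Rightarrow> (real, 'g) vec) \<Rightarrow> 'g \<Rightarrow> (real, 'g) vec \<Rightarrow> (real, 'g) vec" where
  "gs_proj b i x = x - closest_point (span (b ` {..<i})) x"

definition lattice_of :: "('g::finite \<Rightarrow> real ^ 'g) \<Rightarrow> (real ^ 'g) set" where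
  "lattice_of b = range (\<lambda>c :: 'g \<Rightarrow> int. \<Sum>i\<in>UNIV. of_int (c i) *\<^sub>R b i)"

(* Size-reduced, and each Gram-Schmidt vector is a shortest nonzero vector of the
   corresponding projected lattice. *)
definition hkz_basis :: "('g::{finite,linorder} \<Rightarrow> (real, 'g) vec) \<Rightarrow> bool" where
  "hkz_basis b \<longleftrightarrow>
     inj b \<and> independent (range b) \<and>
     (\<forall>i j. i < j \<longrightarrow>
        \<bar>b j \<bullet> gs_proj b i (b i)\<bar> \<le> 1/2 * (gs_proj b i (b i) \<bullet> gs_proj b i (b i))) \<and>
     (\<forall>i. \<forall>x\<in>lattice_of b. gs_proj b i x \<noteq> 0 \<longrightarrow>
        norm (gs_proj b i (b i)) \<le> norm (gs_proj b i x))"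

(* The basis with Gram matrix S is unique up to an isometry, so the choice of b is
   immaterial; its existence makes S symmetric positive definite. *)
definition hkz_reduced :: "((real, 'g::{finite,linorder}) vec, 'g) vec \<Rightarrow> bool" where
  "hkz_reduced S \<longleftrightarrow> (\<exists>b. hkz_basis b \<and> S = (\<chi> i j. b i \<bullet> b j))"

(* The permutation matrix of the order-reversing bijection: i and j correspond if there are
   as many indices below i as above j. *)
definition rev_mat :: "((real, 'g::{finite,linorder}) vec, 'g) vec" where
  "rev_mat = (\<chi> i j. if card {..<i} = card {j<..} then 1 else 0)"

definition reciprocal_hkz_reduced :: "((real, 'g::{finite,linorder}) vec, 'g) vec \<Rightarrow> bool" where
  "reciprocal_hkz_reduced Y \<longleftrightarrow> hkz_reduced (rev_mat ** matrix_inv Y ** rev_mat)"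

definition reduced_matrix :: "((complex, 'g::{finite,linorder}) vec, 'g) vec \<Rightarrow> bool" where
  "reduced_matrix \<tau> \<longleftrightarrow>
     \<tau> \<in> siegel \<and> reciprocal_hkz_reduced (Im_mat \<tau>) \<and>
     (\<forall>n\<in>int_vecs. n \<noteq> 0 \<longrightarrow> n \<bullet> (Im_mat \<tau> *v n) \<ge> sqrt 3 / 2)"

definition reduced_point :: "(complex, 'g::{finite,linorder}) vec \<Rightarrow> ((complex, 'g) vec, 'g) vec \<Rightarrow> bool" where
  "reduced_point z \<tau> \<longleftrightarrow>
     reduced_matrix \<tau> \<and> infnorm (- (matrix_inv (Im_mat \<tau>) *v Im_vec z)) \<le> 1"

definition grid :: "nat \<Rightarrow> (real ^ 'g) set" where
  "grid D = {t. \<forall>i. \<exists>m<D. t $ i = real m / real D}"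

end

theory Submission
  imports Defs "HOL-Computational_Algebra.Fundamental_Theorem_Algebra"
begin

text \<open>Write \<open>g\<close> for the genus. Each function of \<open>t\<close> in the theorem is, up to a phase, a series
  \<open>\<Sum>k. C k * exp (2 * pi * \<i> * q * (k \<bullet> t))\<close> with \<open>k\<close> integral, \<open>q\<close> a power of two and
  \<open>norm (C k) = exp (- 2 ^ j * norm\<^sup>2)\<close>, so its largest coefficient is exactly the Gaussian factor of the
  bound. The terms that matter lie in a box around the centre \<open>v\<close> whose side depends on \<open>g\<close> only.
  This is where reducedness enters: Minkowski's bound, applied to all segments of the
  Hermite--Korkine--Zolotarev basis, makes the ratios of the Gram--Schmidt lengths at most
  quasi-polynomial in \<open>g\<close>, and rounding with the nearest plane algorithm compares the norm of a point
  with the distance to the lattice one coordinate at a time.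

  On the box the series is a polynomial in the \<open>exp (2 * pi * \<i> * q * t i)\<close> of degree bounded in each
  variable. A univariate polynomial is at least as large as any of its coefficients, up to a constant
  to the power of the degree, at all points of the unit circle outside small arcs, one for each root;
  treating the variables one after the other gives the multivariate version. The excluded arcs have
  total proportion at most one half when their lengths decrease like \<open>2 ^ (- j)\<close>, and the
  truncation error at level \<open>j\<close> is still smaller because the Gaussian decays at scale \<open>2 ^ j\<close>.\<close>

section \<open>Small values of polynomials at roots of unity\<close>

text \<open>The largest coefficient may sit anywhere in the box, so the polynomial estimate has to
  hold for every coefficient; the leading one may be minute. It loses \<open>\<epsilon> ^ g\<close>
  with \<open>\<epsilon> = (\<delta> / 4) ^ d\<close>, so everything rests on a degree d that is
  free of \<tau>, z, j and h. This is why the box is cut out by the excess of the squared norm over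
  its minimum, with one threshold for all levels. The grid forces D to be large: at frequency q only
  D / q values of the exponential occur, each q times, so a root may spoil q points of a coordinate
  beyond the length of its arc. With 2^g vectors a and frequencies up to 2^h this costs multiples of
  2^(g+h) / D, and the pairs (a, b) cost multiples of 2^(2g) / D. With L = 1 + (ln g)^2, the factor
  2^(20 L) in D pays for g * d, the number of roots met by one function over all variables. The 25 L
  in the bound for \<eta> is 20 L for g * d plus 5 L for the logarithm of the arc length.\<close>

lemma coeff_le_poly_away_from_roots:
  fixes p :: "complex poly"
  assumes "degree p \<le> d" "p \<noteq> 0" "0 < \<delta>" "\<delta> \<le> 1"
  shows "\<exists>R. finite R \<and> card R \<le> d \<and>
    (\<forall>w k. (\<forall>r\<in>R. \<delta> / 2 * max 1 (norm r) \<le> norm (w - r)) \<longrightarrow>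
       norm (coeff p k) * (\<delta> / 4) ^ d \<le> norm (poly p w))"
  using assms(1,2)
proof (induction d arbitrary: p)
  case 0
  then obtain c where p: "p = [:c:]"
    using degree_eq_zeroE by blast
  have "norm (coeff p k) \<le> norm (poly p w)" for k w
    by (cases k) (auto simp: p)
  then show ?case
    by (intro exI[of _ "{}"]) auto
next
  case (Suc d)
  show ?case
  proof (cases "degree p = 0")
    case True
    then obtain c where p: "p = [:c:]"
      using degree_eq_zeroE by blast
    have "(\<delta> / 4) ^ Suc d \<le> 1"
      using assms(3,4) by (intro power_le_one) auto
    have "norm (coeff p k) * (\<delta> / 4) ^ Suc d \<le> norm (poly p w)" for k w
    proof -
      have "norm (coeff p k) \<le> norm (poly p w)"
        by (cases k) (auto simp: p)
      moreover have "norm (coeff p k) * (\<delta> / 4) ^ Suc d \<le> norm (coeff p k) * 1"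
        by (intro mult_left_mono) (fact, simp)
      ultimately show ?thesis by linarith
    qed
    then show ?thesis
      by (intro exI[of _ "{}"]) auto
  next
    case False
    then have "\<not> constant (poly p)"
      by (simp add: constant_degree)
    then obtain r where r: "poly p r = 0"
      using fundamental_theorem_of_algebra by blast
    then obtain q where p: "p = [:-r, 1:] * q"
      by (auto simp: poly_eq_0_iff_dvd)
    have q0: "q \<noteq> 0"
      using p Suc.prems by auto
    have "degree p = degree q + 1"
      using q0 unfolding p by (subst degree_mult_eq) auto
    then have "degree q \<le> d"
      using Suc.prems by simp
    from Suc.IH[OF this q0] obtain R where R: "finite R" "card R \<le> d"
      "\<And>w k. (\<forall>r\<in>R. \<delta> / 2 * max 1 (norm r) \<le> norm (w - r)) \<Longrightarrow>
         norm (coeff q k) * (\<delta> / 4) ^ d \<le> norm (poly q w)" by blast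
    show ?thesis
    proof (intro exI[of _ "insert r R"] conjI allI impI)
      show "finite (insert r R)" "card (insert r R) \<le> Suc d"
        using R(1,2) by (auto simp: card_insert_if)
      fix w k
      assume w: "\<forall>r\<in>insert r R. \<delta> / 2 * max 1 (norm r) \<le> norm (w - r)"
      define M where "M = norm (poly q w)"
      have M: "norm (coeff q k) * (\<delta> / 4) ^ d \<le> M" for k
        unfolding M_def using w by (intro R(3)) auto
      have M0: "M \<ge> 0" by (simp add: M_def)
      define a where "a = (case k of 0 \<Rightarrow> 0 | Suc l \<Rightarrow> coeff q l)"
      have a: "norm a * (\<delta> / 4) ^ d \<le> M"
        using M M0 by (cases k) (auto simp: a_def)
      \<comment> \<open>Putting the root r back multiplies the coefficient bound by at most
        \<open>1 + norm r\<close>, hence by \<open>2 * max 1 (norm r)\<close>. The radius of the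
        excluded disc is proportional to \<open>max 1 (norm r)\<close> so that
        \<open>norm (w - r)\<close> wins this back up to \<open>\<delta> / 4\<close>.\<close>
      have "coeff p k = a - r * coeff q k"
        by (cases k) (auto simp: p a_def)
      then have "norm (coeff p k) \<le> norm a + norm r * norm (coeff q k)"
        by (metis norm_mult norm_triangle_ineq4)
      then have "norm (coeff p k) * (\<delta> / 4) ^ d \<le> (norm a + norm r * norm (coeff q k)) * (\<delta> / 4) ^ d"
        using assms(3) by (intro mult_right_mono) auto
      also have "\<dots> = norm a * (\<delta> / 4) ^ d + norm r * (norm (coeff q k) * (\<delta> / 4) ^ d)"
        by (simp add: algebra_simps)
      also have "\<dots> \<le> M + norm r * M"
        by (intro add_mono mult_left_mono a M) auto
      also have "\<dots> \<le> 2 * max 1 (norm r) * M"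
      proof -
        have "(1 + norm r) * M \<le> (2 * max 1 (norm r)) * M"
          using M0 by (intro mult_right_mono) auto
        then show ?thesis by (simp add: algebra_simps)
      qed
      finally have *: "norm (coeff p k) * (\<delta> / 4) ^ d \<le> 2 * max 1 (norm r) * M" .
      have "norm (coeff p k) * (\<delta> / 4) ^ Suc d = (norm (coeff p k) * (\<delta> / 4) ^ d) * (\<delta> / 4)"
        by simp
      also have "\<dots> \<le> 2 * max 1 (norm r) * M * (\<delta> / 4)"
        using * assms(3) by (intro mult_right_mono) auto
      also have "\<dots> = (\<delta> / 2 * max 1 (norm r)) * M" by simp
      also have "\<dots> \<le> norm (w - r) * M"
        using w M0 by (intro mult_right_mono) auto
      also have "\<dots> = norm (poly p w)"
        by (simp add: p M_def norm_mult algebra_simps flip: norm_mult)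
      finally show "norm (coeff p k) * (\<delta> / 4) ^ Suc d \<le> norm (poly p w)" .
    qed
  qed
qed

section \<open>Roots of unity close to a given point\<close>

lemma Jordan_sin_ge:
  fixes x :: real
  assumes "0 \<le> x" "x \<le> pi / 2"
  shows "2 / pi * x \<le> sin x"
proof -
  have conc: "concave_on {0..pi/2} (sin :: real \<Rightarrow> real)"
    by (rule f''_le0_imp_concave[where f' = cos and f'' = "\<lambda>x. - sin x"])
      (auto intro!: derivative_eq_intros sin_ge_zero)
  have "(1 - 2 / pi * x) * sin 0 + (2 / pi * x) * sin (pi/2)
     \<le> sin ((1 - 2 / pi * x) *\<^sub>R 0 + (2 / pi * x) *\<^sub>R (pi / 2))"
    using assms by (intro concave_onD[OF conc]) (auto simp: field_simps)
  then show ?thesis by simp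
qed

lemma norm_cis_diff_one: "norm (cis (2 * \<theta>) - 1) = 2 * \<bar>sin \<theta>\<bar>"
proof -
  have "cis (2 * \<theta>) - 1 = cis \<theta> * (cis \<theta> - cis (- \<theta>))"
    by (simp add: right_diff_distrib cis_mult)
  also have "cis \<theta> - cis (- \<theta>) = 2 * \<i> * of_real (sin \<theta>)"
    by (simp add: complex_eq_iff)
  finally show ?thesis
    by (simp add: norm_mult)
qed

text \<open>The chord of an arc of u turns has length \<open>2 * \<bar>sin (pi * u)\<bar>\<close>,
  and Jordan's inequality makes this linear in u up to half a turn.\<close>

lemma norm_cis_diff_ge:
  fixes x y :: real
  shows "4 * \<bar>x - y - of_int (round (x - y))\<bar> \<le> norm (cis (2 * pi * x) - cis (2 * pi * y))"
proof -
  define u where "u = x - y - of_int (round (x - y))"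
  have u: "\<bar>u\<bar> \<le> 1/2"
    using of_int_round_abs_le[of "x - y"] by (simp add: u_def abs_minus_commute)
  have "cis (2 * pi * x) = cis (2 * pi * y) * (cis (2 * (pi * u)) * cis (2 * pi * of_int (round (x - y))))"
    by (simp add: cis_mult u_def algebra_simps)
  moreover have "cis (2 * pi * of_int (round (x - y))) = 1"
    by (rule cis_multiple_2pi) simp
  ultimately have "cis (2 * pi * x) - cis (2 * pi * y) = cis (2 * pi * y) * (cis (2 * (pi * u)) - 1)"
    by (simp add: right_diff_distrib)
  then have "norm (cis (2 * pi * x) - cis (2 * pi * y)) = 2 * \<bar>sin (pi * u)\<bar>"
    by (simp only: norm_mult norm_cis_diff_one) simp
  moreover have "2 * \<bar>u\<bar> \<le> \<bar>sin (pi * u)\<bar>"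
  proof -
    have "2 / pi * (pi * \<bar>u\<bar>) \<le> sin (pi * \<bar>u\<bar>)"
      using u by (intro Jordan_sin_ge) auto
    then show ?thesis by (cases "u \<ge> 0") (auto simp: abs_if)
  qed
  ultimately show ?thesis by (simp add: u_def)
qed

lemma card_ints_lt:
  fixes K :: real
  assumes "0 < K"
  shows "finite {n::int. \<bar>of_int n\<bar> < K}" "real (card {n::int. \<bar>of_int n\<bar> < K}) \<le> 2 * K + 1"
proof -
  have sub: "{n::int. \<bar>of_int n\<bar> < K} \<subseteq> {-\<lfloor>K\<rfloor>..\<lfloor>K\<rfloor>}"
    by (auto simp: le_floor_iff abs_if minus_le_iff split: if_splits)
  then show "finite {n::int. \<bar>of_int n\<bar> < K}"
    using finite_atLeastAtMost_int by (rule finite_subset)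
  have "card {n::int. \<bar>of_int n\<bar> < K} \<le> card {-\<lfloor>K\<rfloor>..\<lfloor>K\<rfloor>}"
    by (rule card_mono[OF _ sub]) simp
  also have "real \<dots> \<le> 2 * K + 1"
    using assms by simp
  finally show "real (card {n::int. \<bar>of_int n\<bar> < K}) \<le> 2 * K + 1" by simp
qed

text \<open>Any two of these roots of unity are closer than \<open>2 * \<delta>\<close> to each other.\<close>
lemma card_roots_of_unity_near:
  fixes r :: complex and \<delta> :: real and D q :: nat
  assumes D: "D > 0" and q: "q dvd D" and \<delta>: "0 < \<delta>" "\<delta> < 1"
  shows "real (card {m. m < D \<and> norm (cis (2 * pi * (q * m / D)) - r) < \<delta> / 2 * max 1 (norm r)})
     \<le> \<delta> * D + q"
proof (cases "\<exists>m0. norm (cis (2 * pi * (q * real m0 / D)) - r) < \<delta> / 2 * max 1 (norm r)")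
  case False
  then show ?thesis using \<delta> by auto
next
  case True
  then obtain m0 :: nat where m0: "norm (cis (2 * pi * (q * real m0 / D)) - r) < \<delta> / 2 * max 1 (norm r)"
    by blast
  obtain D' where D': "D = q * D'" using q by auto
  have q0: "q > 0" and D'0: "D' > 0" using D D' by auto
  define M where "M = {m. m < D \<and> norm (cis (2 * pi * (q * m / D)) - r) < \<delta> / 2 * max 1 (norm r)}"
  define I where "I = {n::int. \<bar>of_int n\<bar> < \<delta> * D' / 2}"
  \<comment> \<open>For \<open>norm r \<ge> 2\<close> the excluded disc misses the unit circle
    because \<open>\<delta> < 1\<close>. So only discs of radius below \<delta> remain.\<close>
  have r2: "max 1 (norm r) < 2"
  proof (rule ccontr)
    assume "\<not> max 1 (norm r) < 2"
    then have "norm r \<ge> 2" by auto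
    have "norm r \<le> norm (cis (2 * pi * (q * m0 / D)) - r) + 1"
      by (metis norm_cis norm_minus_commute norm_triangle_sub add.commute)
    also have "\<dots> < \<delta> / 2 * norm r + 1"
      using m0 \<open>norm r \<ge> 2\<close> by simp
    also have "\<dots> \<le> 1 / 2 * norm r + 1"
      using \<delta> by (intro add_mono mult_right_mono) auto
    finally show False using \<open>norm r \<ge> 2\<close> by simp
  qed
  have eq: "q * real m / D = m / D'" for m
    using q0 D' by simp
  \<comment> \<open>The root of unity depends only on m modulo D' = D / q. The quotient
    \<open>m div D'\<close> has q possibilities; the second component is the displacement from m0,
    made small by a multiple of D', and it determines the residue.\<close>
  define \<phi> where "\<phi> = (\<lambda>m. (m div D', int m - int m0 - int D' * round (real m / D' - real m0 / D')))"
  have "inj_on \<phi> M"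
  proof (rule inj_onI)
    fix m m' assume "\<phi> m = \<phi> m'"
    then have 1: "m div D' = m' div D'"
      and 2: "int m - int m' = int D' * (round (real m / D' - real m0 / D') - round (real m' / D' - real m0 / D'))"
      by (auto simp: \<phi>_def algebra_simps)
    from 2 have "int m mod int D' = int m' mod int D'"
      by (simp add: mod_eq_dvd_iff)
    then have "m mod D' = m' mod D'"
      by (metis of_nat_eq_iff zmod_int)
    with 1 show "m = m'"
      by (metis div_mult_mod_eq)
  qed
  moreover have "\<phi> ` M \<subseteq> {..<q} \<times> I"
  proof
    fix x assume "x \<in> \<phi> ` M"
    then obtain m where m: "m < D" "norm (cis (2 * pi * (q * m / D)) - r) < \<delta> / 2 * max 1 (norm r)"
      and x: "x = \<phi> m" by (auto simp: M_def)
    have "4 * \<bar>real m / D' - real m0 / D' - of_int (round (real m / D' - real m0 / D'))\<bar>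
       \<le> norm (cis (2 * pi * (m / D')) - cis (2 * pi * (m0 / D')))"
      by (rule norm_cis_diff_ge)
    also have "\<dots> \<le> norm (cis (2 * pi * (m / D')) - r) + norm (cis (2 * pi * (m0 / D')) - r)"
      using norm_triangle_ineq4[of "cis (2 * pi * (m / D')) - r" "cis (2 * pi * (m0 / D')) - r"] by simp
    also have "\<dots> < \<delta> * max 1 (norm r)"
      using m m0 by (simp add: eq)
    also have "\<dots> < \<delta> * 2"
      using r2 \<delta> by (intro mult_strict_left_mono) auto
    finally have "\<bar>real m / D' - real m0 / D' - of_int (round (real m / D' - real m0 / D'))\<bar> < \<delta> / 2"
      by simp
    then have "D' * \<bar>real m / D' - real m0 / D' - of_int (round (real m / D' - real m0 / D'))\<bar> < D' * (\<delta> / 2)"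
      using D'0 by (intro mult_strict_left_mono) auto
    also have "D' * \<bar>real m / D' - real m0 / D' - of_int (round (real m / D' - real m0 / D'))\<bar>
       = \<bar>of_int (snd (\<phi> m))\<bar>"
      using D'0 unfolding \<phi>_def by (subst abs_of_pos[of "real D'", symmetric], simp, subst abs_mult[symmetric])
        (simp add: algebra_simps)
    finally have "snd (\<phi> m) \<in> I"
      by (simp add: I_def mult.commute)
    moreover have "fst (\<phi> m) < q"
      using m D' by (simp add: \<phi>_def less_mult_imp_div_less mult.commute)
    ultimately show "x \<in> {..<q} \<times> I"
      using x by (metis lessThan_iff mem_Times_iff)
  qed
  moreover have I: "finite I" "real (card I) \<le> 2 * (\<delta> * D' / 2) + 1"
    unfolding I_def using card_ints_lt[of "\<delta> * D' / 2"] \<delta> D'0 by auto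
  ultimately have "card M \<le> card ({..<q} \<times> I)"
    by (metis card_inj_on_le finite_SigmaI finite_lessThan)
  then have "real (card M) \<le> q * real (card I)"
    by (simp add: card_cartesian_product flip: of_nat_mult)
  also have "\<dots> \<le> q * (2 * (\<delta> * D' / 2) + 1)"
    using I by (intro mult_left_mono) auto
  also have "\<dots> = \<delta> * D + q"
    by (simp add: D' algebra_simps)
  finally show ?thesis by (simp add: M_def)
qed

lemma card_small_values_univariate:
  fixes c :: "nat \<Rightarrow> complex" and \<delta> :: real and D q d k0 :: nat
  assumes D: "D > 0" and q: "q dvd D" and \<delta>: "0 < \<delta>" "\<delta> < 1" and k0: "k0 \<le> d"
  shows "real (card {m. m < D \<and>
     norm (\<Sum>k\<le>d. c k * cis (2 * pi * (q * m / D)) ^ k) < norm (c k0) * (\<delta> / 4) ^ d})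
     \<le> d * (\<delta> * D + q)"
proof (cases "c k0 = 0")
  case True
  then show ?thesis using \<delta> by simp
next
  case False
  define p where "p = (\<Sum>k\<le>d. monom (c k) k)"
  have coeff: "coeff p k = (if k \<le> d then c k else 0)" for k
    by (auto simp: p_def coeff_sum)
  have poly: "poly p w = (\<Sum>k\<le>d. c k * w ^ k)" for w
    by (simp add: p_def poly_sum poly_monom)
  have "degree p \<le> d"
    by (rule degree_le) (auto simp: coeff)
  moreover have "p \<noteq> 0"
    using False k0 coeff[of k0] by auto
  ultimately obtain R where R: "finite R" "card R \<le> d"
    "\<And>w k. (\<forall>r\<in>R. \<delta> / 2 * max 1 (norm r) \<le> norm (w - r)) \<Longrightarrow>
         norm (coeff p k) * (\<delta> / 4) ^ d \<le> norm (poly p w)"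
    using coeff_le_poly_away_from_roots[of p d \<delta>] \<delta> by auto
  define N where "N r = {m. m < D \<and> norm (cis (2 * pi * (q * m / D)) - r) < \<delta> / 2 * max 1 (norm r)}" for r
  have "{m. m < D \<and> norm (\<Sum>k\<le>d. c k * cis (2 * pi * (q * m / D)) ^ k) < norm (c k0) * (\<delta> / 4) ^ d}
     \<subseteq> (\<Union>r\<in>R. N r)" (is "?B \<subseteq> _")
  proof
    fix m assume m: "m \<in> ?B"
    then have "\<not> norm (coeff p k0) * (\<delta> / 4) ^ d \<le> norm (poly p (cis (2 * pi * (q * m / D))))"
      using k0 by (simp add: coeff poly)
    then show "m \<in> (\<Union>r\<in>R. N r)"
      using R(3)[of "cis (2 * pi * (q * m / D))" k0] m by (force simp: N_def not_le)
  qed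
  then have "card ?B \<le> card (\<Union>r\<in>R. N r)"
    using R(1) by (intro card_mono) (auto simp: N_def)
  also have "\<dots> \<le> (\<Sum>r\<in>R. card (N r))"
    by (rule card_UN_le[OF R(1)])
  finally have "real (card ?B) \<le> (\<Sum>r\<in>R. real (card (N r)))"
    by (simp flip: of_nat_sum)
  also have "\<dots> \<le> (\<Sum>r\<in>R. \<delta> * D + q)"
    unfolding N_def by (intro sum_mono card_roots_of_unity_near assms)
  also have "\<dots> \<le> d * (\<delta> * D + q)"
    using R(2) \<delta> by (simp add: mult_right_mono)
  finally show ?thesis .
qed

text \<open>Regard the sum as a polynomial in one variable i whose coefficients depend on the
  others. If its value is small, then either the coefficient at exponent \<open>k0 i\<close> is
  already small, which is rare by induction, or the value is small compared with that coefficient,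
  which is rare by the univariate bound. The extra factor D on the left avoids
  \<open>D ^ (card I - 1)\<close>.\<close>

lemma card_small_values_multivariate:
  fixes w :: "nat \<Rightarrow> complex" and c :: "('i \<Rightarrow> nat) \<Rightarrow> complex" and \<epsilon> B :: real and D d :: nat
  assumes univariate: "\<And>c k0. k0 \<le> d \<Longrightarrow>
      real (card {m. m < D \<and> norm (\<Sum>k\<le>d. c k * w m ^ k) < norm (c k0) * \<epsilon>}) \<le> B"
    and "0 < \<epsilon>" "finite I" "k0 \<in> I \<rightarrow>\<^sub>E {..d}"
  shows "real (card {f \<in> I \<rightarrow>\<^sub>E {..<D}.
      norm (\<Sum>k \<in> I \<rightarrow>\<^sub>E {..d}. c k * (\<Prod>i\<in>I. w (f i) ^ k i)) < norm (c k0) * \<epsilon> ^ card I}) * D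
     \<le> card I * B * D ^ card I"
  using assms(3,4)
proof (induction I arbitrary: c k0 rule: finite_induct)
  case empty
  then show ?case by simp
next
  case (insert i I)
  define a0 where "a0 = k0 i"
  define k0' where "k0' = k0(i := undefined)"
  have k0': "k0' \<in> I \<rightarrow>\<^sub>E {..d}" "a0 \<le> d" and k0_eq: "k0 = k0'(i := a0)"
    using insert.prems insert.hyps(2) by (auto simp: k0'_def a0_def PiE_def extensional_def)
  define q where "q f a = (\<Sum>k \<in> I \<rightarrow>\<^sub>E {..d}. c (k(i := a)) * (\<Prod>j\<in>I. w (f j) ^ k j))" for f a
  have total: "(\<Sum>k \<in> insert i I \<rightarrow>\<^sub>E {..d}. c k * (\<Prod>j\<in>insert i I. w ((f(i := m)) j) ^ k j))
      = (\<Sum>a\<le>d. q f a * w m ^ a)" for f m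
  proof -
    have "(\<Sum>k \<in> insert i I \<rightarrow>\<^sub>E {..d}. c k * (\<Prod>j\<in>insert i I. w ((f(i := m)) j) ^ k j))
       = (\<Sum>(a, k)\<in>{..d} \<times> (I \<rightarrow>\<^sub>E {..d}). c (k(i := a)) * (\<Prod>j\<in>insert i I. w ((f(i := m)) j) ^ (k(i := a)) j))"
      unfolding PiE_insert_eq
      by (subst sum.reindex[OF inj_combinator[OF insert.hyps(2)]]) (simp add: case_prod_unfold)
    also have "\<dots> = (\<Sum>(a, k)\<in>{..d} \<times> (I \<rightarrow>\<^sub>E {..d}). c (k(i := a)) * (\<Prod>j\<in>I. w (f j) ^ k j) * w m ^ a)"
    proof (intro sum.cong refl, clarify)
      fix a k
      have "(\<Prod>j\<in>I. w ((f(i := m)) j) ^ (k(i := a)) j) = (\<Prod>j\<in>I. w (f j) ^ k j)"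
        using insert.hyps(2) by (intro prod.cong) auto
      then show "c (k(i := a)) * (\<Prod>j\<in>insert i I. w ((f(i := m)) j) ^ (k(i := a)) j)
         = c (k(i := a)) * (\<Prod>j\<in>I. w (f j) ^ k j) * w m ^ a"
        using insert.hyps by (simp add: prod.insert del: fun_upd_apply) simp
    qed
    also have "\<dots> = (\<Sum>a\<le>d. q f a * w m ^ a)"
      by (simp add: q_def sum.cartesian_product[symmetric] sum_distrib_right)
    finally show ?thesis .
  qed
  define P where "P = I \<rightarrow>\<^sub>E {..<D}"
  have P: "finite P" "card P = D ^ card I"
    using insert.hyps(1) by (auto simp: P_def card_PiE intro: finite_PiE)
  define B1 where "B1 = {f \<in> P. norm (q f a0) < norm (c k0) * \<epsilon> ^ card I}"
  define B2 where "B2 f = {m. m < D \<and> norm (\<Sum>a\<le>d. q f a * w m ^ a) < norm (q f a0) * \<epsilon>}" for f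
  define Bad where "Bad = {f \<in> insert i I \<rightarrow>\<^sub>E {..<D}.
      norm (\<Sum>k \<in> insert i I \<rightarrow>\<^sub>E {..d}. c k * (\<Prod>j\<in>insert i I. w (f j) ^ k j))
        < norm (c k0) * \<epsilon> ^ card (insert i I)}"
  have fin: "finite B1" "\<And>f. finite (B2 f)"
    using P by (auto simp: B1_def B2_def)
  have "Bad \<subseteq> (\<lambda>(f, m). f(i := m)) ` (B1 \<times> {..<D} \<union> Sigma P B2)"
  proof
    fix f assume f: "f \<in> Bad"
    then have "f \<in> insert i I \<rightarrow>\<^sub>E {..<D}" by (simp add: Bad_def)
    then obtain m f' where m: "m < D" "f' \<in> P" "f = f'(i := m)"
      unfolding PiE_insert_eq P_def by auto
    have "norm (\<Sum>a\<le>d. q f' a * w m ^ a) < norm (c k0) * \<epsilon> ^ card I * \<epsilon>"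
      using f insert.hyps unfolding Bad_def m(3) mem_Collect_eq total by (simp add: mult_ac)
    then have "norm (q f' a0) < norm (c k0) * \<epsilon> ^ card I \<or>
        norm (\<Sum>a\<le>d. q f' a * w m ^ a) < norm (q f' a0) * \<epsilon>"
      using \<open>0 < \<epsilon>\<close> by (smt (verit) mult_right_mono)
    then have "(f', m) \<in> B1 \<times> {..<D} \<union> Sigma P B2"
      using m by (auto simp: B1_def B2_def)
    then show "f \<in> (\<lambda>(f, m). f(i := m)) ` (B1 \<times> {..<D} \<union> Sigma P B2)"
      using m(3) by (auto intro!: image_eqI[of _ _ "(f', m)"])
  qed
  then have "card Bad \<le> card (B1 \<times> {..<D} \<union> Sigma P B2)"
    using fin P by (intro surj_card_le) auto
  also have "\<dots> \<le> card (B1 \<times> {..<D}) + card (Sigma P B2)"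
    by (rule card_Un_le)
  also have "card (Sigma P B2) = (\<Sum>f\<in>P. card (B2 f))"
    using fin P by (subst card_SigmaI) auto
  finally have "real (card Bad) \<le> real (card B1) * D + (\<Sum>f\<in>P. real (card (B2 f)))"
    by (simp add: card_cartesian_product flip: of_nat_sum of_nat_mult of_nat_add)
  also have "real (card B1) * D \<le> card I * B * D ^ card I"
    using insert.IH[OF k0'(1), of "\<lambda>k. c (k(i := a0))"]
    unfolding B1_def P_def q_def k0_eq .
  also have "(\<Sum>f\<in>P. real (card (B2 f))) \<le> (\<Sum>f\<in>P. B)"
    unfolding B2_def using k0'(2) by (intro sum_mono univariate)
  also have "\<dots> = B * D ^ card I"
    using P by simp
  finally have "real (card Bad) \<le> (card I + 1) * B * D ^ card I"
    by (simp add: algebra_simps)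
  then have "real (card Bad) * D \<le> (card I + 1) * B * D ^ card I * D"
    by (rule mult_right_mono) simp
  then show ?case
    using insert.hyps unfolding Bad_def by (simp add: mult_ac)
qed

section \<open>Profiles of Hermite--Korkine--Zolotarev bases\<close>

text \<open>Serves \<open>dependent_wf_choice\<close>: coordinates of a triangular system are chosen
  from the largest index downwards. \<open>wf_less_finite\<close> serves the opposite order.\<close>

lemma wf_greater_finite: "wf {(m, k :: 'i :: {finite, linorder}). k < m}"
proof (rule wf_subset)
  show "{(m, k). k < m} \<subseteq> Wellfounded.measure (\<lambda>k :: 'i. card {k<..})"
    by (auto intro!: psubset_card_mono)
qed simp

lemma wf_less_finite: "wf {(m, k :: 'i :: {finite, linorder}). m < k}"
proof (rule wf_subset)
  show "{(m, k). m < k} \<subseteq> Wellfounded.measure (\<lambda>k :: 'i. card {..<k})"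
    by (auto intro!: psubset_card_mono)
qed simp

text \<open>Pigeonhole for the lattice with a triangular basis of diagonal entries
  \<open>a k\<close>: lattice vectors in a large cube of side X outnumber its cells of side s, and
  two vectors in one cell differ by the vector sought. The factor \<open>2 ^ card J\<close>, absent
  from the sharp theorem, pays for rounding at the boundary of the cube.\<close>

lemma Minkowski_triangular:
  fixes \<mu> :: "'i \<Rightarrow> 'i :: {finite, linorder} \<Rightarrow> real" and a :: "'i \<Rightarrow> real" and s :: real
  assumes J: "J \<noteq> {}" and a: "\<And>k. k \<in> J \<Longrightarrow> 0 < a k"
    and s: "0 < s" "2 ^ card J * (\<Prod>k\<in>J. a k) \<le> s ^ card J"
  obtains c :: "'i \<Rightarrow> int" where "\<exists>k\<in>J. c k \<noteq> 0" "\<And>k. k \<notin> J \<Longrightarrow> c k = 0"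
    "\<And>k. k \<in> J \<Longrightarrow> \<bar>c k + (\<Sum>m\<in>{m\<in>J. k < m}. c m * \<mu> m k)\<bar> * a k < s"
proof -
  define y where "y c k = real_of_int (c k) + (\<Sum>m\<in>{m\<in>J. k < m}. real_of_int (c m) * \<mu> m k)"
    for c :: "'i \<Rightarrow> int" and k
  \<comment> \<open>Four times the largest length, so that rounding costs at most a quarter: at most
    \<open>5/4 * X / s\<close> cells against at least \<open>3/4 * (X / a k)\<close> choices in each
    direction, and 5/4 < 2 * 3/4.\<close>
  define X where "X = 4 * Max (insert s (a ` J))"
  have X: "4 * s \<le> X" "\<And>k. k \<in> J \<Longrightarrow> 4 * a k \<le> X"
    unfolding X_def by (auto intro!: mult_left_mono Max_ge)
  then have X0: "X > 0" using s by simp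
  define N where "N k = nat \<lfloor>X / a k\<rfloor>" for k
  \<comment> \<open>Once the entries \<open>c m\<close> with m > k are fixed, an integer shift by
    \<open>c k\<close> places the k-th triangular coordinate in any prescribed unit
    interval.\<close>
  have "\<exists>c. \<forall>k. real (e k) \<le> y c k \<and> y c k < real (e k) + 1" for e :: "'i \<Rightarrow> nat"
  proof -
    define P where "P c k r \<longleftrightarrow> real (e k) \<le> r + (\<Sum>m\<in>{m\<in>J. k < m}. real_of_int (c m) * \<mu> m k) \<and>
        r + (\<Sum>m\<in>{m\<in>J. k < m}. real_of_int (c m) * \<mu> m k) < real (e k) + 1"
      for c :: "'i \<Rightarrow> int" and k and r :: int
    have "\<exists>c. \<forall>k. P c k (c k)"
    proof (rule dependent_wf_choice[OF wf_greater_finite])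
      fix f g :: "'i \<Rightarrow> int" and k r
      assume "\<And>z. (z, k) \<in> {(m, k). k < m} \<Longrightarrow> f z = g z"
      then have "(\<Sum>m\<in>{m\<in>J. k < m}. real_of_int (f m) * \<mu> m k) = (\<Sum>m\<in>{m\<in>J. k < m}. real_of_int (g m) * \<mu> m k)"
        by (intro sum.cong) auto
      then show "P f k r = P g k r" by (simp add: P_def)
    next
      fix k f
      show "\<exists>r. P f k r"
        unfolding P_def
        by (rule exI[of _ "\<lceil>real (e k) - (\<Sum>m\<in>{m\<in>J. k < m}. real_of_int (f m) * \<mu> m k)\<rceil>"]) linarith
    qed
    then show ?thesis by (simp add: P_def y_def)
  qed
  then obtain C where C: "\<And>e k. real (e k) \<le> y (C e) k" "\<And>e k. y (C e) k < real (e k) + 1"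
    by metis
  define E where "E = (\<Pi>\<^sub>E k\<in>J. {..<N k})"
  define M where "M = nat \<lfloor>X / s\<rfloor>"
  define cell where "cell e = (\<lambda>k\<in>J. nat \<lfloor>y (C e) k * a k / s\<rfloor>)" for e
  have cell: "cell ` E \<subseteq> J \<rightarrow>\<^sub>E {..M}"
  proof (clarsimp simp: cell_def)
    fix e k assume e: "e \<in> E" and k: "k \<in> J"
    then have "e k < N k" by (auto simp: E_def)
    then have "real (e k) + 1 \<le> real (N k)" by linarith
    also have "\<dots> \<le> X / a k"
      using a[OF k] X0 by (simp add: N_def)
    finally have "y (C e) k \<le> X / a k"
      using C(2)[of e k] by linarith
    then have "y (C e) k * a k / s \<le> X / s"
      using a[OF k] s by (simp add: field_simps)
    then show "nat \<lfloor>y (C e) k * a k / s\<rfloor> \<le> M"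
      unfolding M_def by (intro nat_mono floor_mono)
  qed
  have "card (J \<rightarrow>\<^sub>E {..M}) < card E"
  proof -
    have "real (card (J \<rightarrow>\<^sub>E {..M})) = (real M + 1) ^ card J"
      by (simp add: card_PiE add.commute)
    also have "\<dots> \<le> (5/4 * X / s) ^ card J"
    proof (rule power_mono)
      have "real M \<le> X / s" using X0 s by (simp add: M_def)
      moreover have "1 \<le> 1/4 * X / s" using X(1) s by (simp add: field_simps)
      ultimately show "real M + 1 \<le> 5/4 * X / s" by linarith
    qed simp
    also have "\<dots> = (5/4 * X) ^ card J / s ^ card J"
      by (simp add: power_divide)
    also have "\<dots> \<le> (5/4 * X) ^ card J / (2 ^ card J * (\<Prod>k\<in>J. a k))"
      using s X0 a by (intro divide_left_mono mult_pos_pos prod_pos zero_less_power) auto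
    also have "\<dots> = (5/8) ^ card J * (\<Prod>k\<in>J. X / a k)"
      by (simp add: prod_dividef power_divide power_mult_distrib)
        (simp add: field_simps flip: power_mult_distrib)
    also have "\<dots> < (3/4) ^ card J * (\<Prod>k\<in>J. X / a k)"
      using a X0 J by (intro mult_strict_right_mono prod_pos power_strict_mono) (auto simp: card_gt_0_iff)
    also have "\<dots> = (\<Prod>k\<in>J. 3/4 * (X / a k))"
      by (simp only: prod.distrib prod_constant)
    also have "\<dots> \<le> (\<Prod>k\<in>J. real (N k))"
    proof (rule prod_mono)
      fix k assume k: "k \<in> J"
      have "1 \<le> 1/4 * (X / a k)" using X(2)[OF k] a[OF k] by (simp add: field_simps)
      then show "0 \<le> 3/4 * (X / a k) \<and> 3/4 * (X / a k) \<le> real (N k)"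
        unfolding N_def by linarith
    qed
    also have "\<dots> = real (card E)"
      by (simp add: E_def card_PiE)
    finally show ?thesis by simp
  qed
  moreover have "finite (J \<rightarrow>\<^sub>E {..M})" "finite E"
    by (auto intro!: finite_PiE simp: E_def)
  ultimately have "\<not> inj_on cell E"
    using card_inj_on_le[OF _ cell] by linarith
  then obtain e e' where e: "e \<in> E" "e' \<in> E" "e \<noteq> e'" "cell e = cell e'"
    by (auto simp: inj_on_def)
  define c where "c k = (if k \<in> J then C e k - C e' k else 0)" for k
  have yc: "y c k = y (C e) k - y (C e') k" if "k \<in> J" for k
  proof -
    have "(\<Sum>m\<in>{m\<in>J. k < m}. real_of_int (c m) * \<mu> m k)
        = (\<Sum>m\<in>{m\<in>J. k < m}. real_of_int (C e m) * \<mu> m k - real_of_int (C e' m) * \<mu> m k)"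
      by (intro sum.cong) (auto simp: c_def algebra_simps)
    then show ?thesis using that by (simp add: y_def c_def sum_subtractf)
  qed
  show ?thesis
  proof
    show "\<exists>k\<in>J. c k \<noteq> 0"
    proof (rule ccontr)
      assume "\<not> (\<exists>k\<in>J. c k \<noteq> 0)"
      then have "c k = 0" for k by (auto simp: c_def)
      then have "y c k = 0" for k by (simp add: y_def)
      with yc have "y (C e) k = y (C e') k" if "k \<in> J" for k
        using that by (metis eq_iff_diff_eq_0)
      then have "e k = e' k" if "k \<in> J" for k
        using C(1)[of e k] C(2)[of e k] C(1)[of e' k] C(2)[of e' k] that by force
      with e have "e = e'"
        by (auto simp: E_def intro: PiE_ext)
      with e show False by simp
    qed
    show "c k = 0" if "k \<notin> J" for k
      using that by (simp add: c_def)
    show "\<bar>c k + (\<Sum>m\<in>{m\<in>J. k < m}. c m * \<mu> m k)\<bar> * a k < s" if k: "k \<in> J" for k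
    proof -
      have nonneg: "0 \<le> y (C e) k * a k / s" "0 \<le> y (C e') k * a k / s"
        using C(1)[of e k] C(1)[of e' k] a[OF k] s by (auto intro!: divide_nonneg_pos mult_nonneg_nonneg order_trans[OF of_nat_0_le_iff])
      have "cell e k = cell e' k" using e by simp
      then have "\<lfloor>y (C e) k * a k / s\<rfloor> = \<lfloor>y (C e') k * a k / s\<rfloor>"
        using k nonneg by (simp add: cell_def eq_nat_nat_iff)
      then have "\<bar>y (C e) k * a k / s - y (C e') k * a k / s\<bar> < 1"
        by linarith
      also have "y (C e) k * a k / s - y (C e') k * a k / s = y c k * a k / s"
        by (simp add: yc[OF k] algebra_simps diff_divide_distrib)
      finally show ?thesis
        using s a[OF k] by (simp add: y_def abs_mult)
    qed
  qed
qed

text \<open>Unlike a bound of size-reduced type (ratio exponential in the length), averaging the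
  Minkowski bounds of all segments ending in \<open>i\<close> produces only harmonic growth of the logarithms.\<close>
lemma segment_averages_imp_harmonic_bound:
  fixes y :: "'i :: {finite, linorder} \<Rightarrow> real" and c :: real
  assumes avg: "\<And>j. j < i \<Longrightarrow> card {j..i} * y j \<le> card {j..i} * c + (\<Sum>k\<in>{j..i}. y k)"
    and "0 \<le> c" "j < i"
  shows "y j - y i \<le> c * (1 + harm (card {j<..i}))"
proof -
  have step: "card {j<..i} * (y j - y i) \<le> (card {j<..i} + 1) * c + (\<Sum>k\<in>{j<..i}. y k - y i)"
    if "j < i" for j
  proof -
    have eq: "{j..i} = insert j {j<..i}" using that by auto
    then have "card {j..i} = card {j<..i} + 1" by simp
    moreover have "(\<Sum>k\<in>{j..i}. y k) = y j + (\<Sum>k\<in>{j<..i}. y k)"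
      unfolding eq by simp
    ultimately show ?thesis
      using avg[OF that] by (simp add: sum_subtractf algebra_simps)
  qed
  \<comment> \<open>If Z is the sum over n indices and Z' the sum after adding the next lower index,
    then \<open>Z' / (n + 1) \<le> Z / n + c / n\<close>. So the averages grow like a harmonic
    sum.\<close>
  have Z: "(\<Sum>k\<in>{j<..i}. y k - y i) \<le> card {j<..i} * (c * harm (card {j<..i} - 1))" if "j < i" for j
    using that
  proof (induction "card {j<..i}" arbitrary: j rule: less_induct)
    case less
    define j' where "j' = Min {j<..i}"
    have ne: "{j<..i} \<noteq> {}" using less.prems by auto
    have j': "j < j'" "j' \<le> i" using Min_in[OF _ ne] by (auto simp: j'_def)
    have le: "j' \<le> k" if "j < k" "k \<le> i" for k
      using that by (auto simp: j'_def)
    have eq: "{j<..i} = insert j' {j'<..i}"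
    proof (intro equalityI subsetI)
      fix k assume "k \<in> {j<..i}"
      then show "k \<in> insert j' {j'<..i}" using le[of k] by auto
    next
      fix k assume "k \<in> insert j' {j'<..i}"
      then show "k \<in> {j<..i}" using j' by auto
    qed
    then have card: "card {j<..i} = card {j'<..i} + 1" by simp
    show ?case
    proof (cases "j' = i")
      case True
      then show ?thesis using eq by (simp add: harm_def)
    next
      case False
      then have ji: "j' < i" using j' by simp
      define n where "n = card {j'<..i}"
      define Z where "Z = (\<Sum>k\<in>{j'<..i}. y k - y i)"
      have n0: "n > 0" using ji by (auto simp: n_def card_gt_0_iff)
      have IH: "Z \<le> n * (c * harm (n - 1))"
        unfolding n_def Z_def using card ji by (intro less.hyps) auto
      have st: "n * (y j' - y i) \<le> (n + 1) * c + Z"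
        using step[OF ji] by (simp add: n_def Z_def)
      have harm: "harm n = harm (n - 1) + 1 / (n::real)"
        using n0 harm_Suc[of "n - 1", where ?'a = real] by (simp add: field_simps)
      have "real n * (\<Sum>k\<in>{j<..i}. y k - y i) = n * (y j' - y i) + n * Z"
        unfolding eq Z_def by (simp add: algebra_simps)
      also have "\<dots> \<le> (n + 1) * c + (n + 1) * Z"
        using st by (simp add: algebra_simps)
      also have "\<dots> \<le> (n + 1) * c + (n + 1) * (n * (c * harm (n - 1)))"
        using IH by (intro add_left_mono mult_left_mono) auto
      also have "\<dots> = n * ((n + 1) * (c * harm n))"
        using n0 by (simp add: harm field_simps)
      finally have "(\<Sum>k\<in>{j<..i}. y k - y i) \<le> (n + 1) * (c * harm n)"
        using n0 by simp
      then show ?thesis using card by (simp add: n_def)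
    qed
  qed
  define n where "n = card {j<..i}"
  have n0: "n > 0" using \<open>j < i\<close> by (auto simp: n_def card_gt_0_iff)
  have harm: "harm n = harm (n - 1) + 1 / (n::real)"
    using n0 harm_Suc[of "n - 1", where ?'a = real] by (simp add: field_simps)
  have "n * (y j - y i) \<le> (n + 1) * c + n * (c * harm (n - 1))"
    using step[OF \<open>j < i\<close>] Z[OF \<open>j < i\<close>] by (simp add: n_def)
  also have "\<dots> = n * (c * (1 + harm n))"
    using n0 by (simp add: harm field_simps)
  finally show ?thesis using n0 by (simp add: n_def)
qed

lemma harm_le_1_plus_ln:
  assumes "n > 0"
  shows "harm n \<le> 1 + ln (real n)"
  using assms
proof (induction n rule: nat_induct_non_zero)
  case (Suc n)
  have "ln (real n / real (Suc n)) \<le> real n / real (Suc n) - 1"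
    using Suc.hyps by (intro ln_le_minus_one) auto
  also have "\<dots> = - 1 / real (Suc n)" by (simp add: field_simps)
  finally have "inverse (real (Suc n)) \<le> ln (Suc n) - ln n"
    using Suc.hyps by (simp add: ln_div inverse_eq_divide)
  then show ?case using Suc.IH by (simp add: harm_Suc)
qed (simp add: harm_def)

text \<open>This is \<open>(4 * g) powr (2 + ln g)\<close>: Minkowski's bound on one segment loses
  at most \<open>ln (4 * g)\<close> in the logarithm, and \<open>2 + ln g\<close> dominates the
  factor \<open>1 + harm n\<close> produced by averaging.\<close>

definition hkz_factor :: "nat \<Rightarrow> real" where
  "hkz_factor g = exp (ln (4 * real g) * (2 + ln (real g)))"

text \<open>The hypothesis \<open>shortest\<close> is the Hermite--Korkine--Zolotarev condition in Gram--Schmidt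
  coordinates: \<open>l k\<close> is the squared length of the Gram--Schmidt vector \<open>k\<close>.\<close>
lemma hkz_profile:
  fixes l :: "'i :: {finite, linorder} \<Rightarrow> real" and \<mu> :: "'i \<Rightarrow> 'i \<Rightarrow> real"
  assumes l: "\<And>k. 0 < l k"
    and shortest: "\<And>c :: 'i \<Rightarrow> int. \<And>j. \<exists>k\<ge>j. c k \<noteq> (0::int) \<Longrightarrow>
        l j \<le> (\<Sum>k\<in>{j..}. l k * (c k + (\<Sum>m\<in>{k<..}. c m * \<mu> m k))\<^sup>2)"
    and "j \<le> i"
  shows "l j \<le> hkz_factor CARD('i) * l i"
proof (cases "j = i")
  case True
  have "1 \<le> real CARD('i)" by (simp add: Suc_le_eq)
  then have "0 \<le> ln (4 * real CARD('i))" "0 \<le> ln (real CARD('i))"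
    by (intro ln_ge_zero; linarith)+
  then have "0 \<le> ln (4 * real CARD('i)) * (2 + ln (real CARD('i)))"
    by simp
  then have "1 \<le> hkz_factor CARD('i)" by (simp add: hkz_factor_def)
  then have "1 * l i \<le> hkz_factor CARD('i) * l i"
    using l[of i] by (intro mult_right_mono) auto
  then show ?thesis using True by simp
next
  case False
  then have ji: "j < i" using \<open>j \<le> i\<close> by simp
  define g where "g = CARD('i)"
  have g: "g \<ge> 1" by (simp add: g_def Suc_le_eq)
  define c where "c = ln (4 * real g)"
  have c: "c \<ge> 0" using g by (simp add: c_def)
  have avg: "card {j..i} * ln (l j) \<le> card {j..i} * c + (\<Sum>k\<in>{j..i}. ln (l k))" if ji: "j < i" for j
  proof -
    define J where "J = {j..i}"
    define m where "m = card J"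
    have m0: "m > 0" using ji by (auto simp: m_def J_def card_gt_0_iff)
    have mg: "m \<le> g" unfolding m_def g_def by (rule card_mono) auto
    define \<Lambda> where "\<Lambda> = (\<Sum>k\<in>J. ln (l k))"
    \<comment> \<open>The smallest s that Minkowski's bound admits: twice the geometric mean of the
      Gram--Schmidt lengths over J. Hence \<open>m * s\<^sup>2\<close> is \<open>4 * m\<close> times
      the geometric mean of the \<open>l k\<close>.\<close>
    define s where "s = exp (ln 2 + \<Lambda> / (2 * m))"
    have "s ^ m = exp (m * (ln 2 + \<Lambda> / (2 * m)))"
      by (simp add: s_def exp_of_nat_mult)
    also have "m * (ln 2 + \<Lambda> / (2 * m)) = m * ln 2 + \<Lambda> / 2"
      using m0 by (simp add: field_simps)
    also have "exp \<dots> = 2 ^ m * exp (\<Lambda> / 2)"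
      by (simp add: exp_add exp_of_nat_mult)
    also have "exp (\<Lambda> / 2) = (\<Prod>k\<in>J. exp (ln (l k) / 2))"
      by (simp add: \<Lambda>_def exp_sum sum_divide_distrib)
    also have "\<dots> = (\<Prod>k\<in>J. sqrt (l k))"
      using l by (intro prod.cong refl) (subst ln_sqrt[symmetric], auto intro: less_imp_le)
    finally have sm: "s ^ m = 2 ^ m * (\<Prod>k\<in>J. sqrt (l k))" .
    obtain z :: "'i \<Rightarrow> int" where z: "\<exists>k\<in>J. z k \<noteq> 0" "\<And>k. k \<notin> J \<Longrightarrow> z k = 0"
      "\<And>k. k \<in> J \<Longrightarrow> \<bar>z k + (\<Sum>m\<in>{m\<in>J. k < m}. z m * \<mu> m k)\<bar> * sqrt (l k) < s"
    proof (rule Minkowski_triangular)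
      show "J \<noteq> {}" using ji by (auto simp: J_def)
      show "0 < sqrt (l k)" for k using l by simp
      show "0 < s" by (simp add: s_def)
      show "2 ^ card J * (\<Prod>k\<in>J. sqrt (l k)) \<le> s ^ card J"
        using sm by (simp add: m_def)
    qed (rule that)
    have sums: "(\<Sum>m\<in>{k<..}. z m * \<mu> m k) = (\<Sum>m\<in>{m\<in>J. k < m}. z m * \<mu> m k)" for k
      by (rule sum.mono_neutral_right) (use z(2) in auto)
    \<comment> \<open>Coordinates below j are projected away and those above i vanish because z is
      supported on J. This leaves m coordinates, each of length below s.\<close>
    have "l j \<le> (\<Sum>k\<in>{j..}. l k * (z k + (\<Sum>m\<in>{k<..}. z m * \<mu> m k))\<^sup>2)"
      using z(1) by (intro shortest) (auto simp: J_def)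
    also have "\<dots> = (\<Sum>k\<in>J. l k * (z k + (\<Sum>m\<in>{k<..}. z m * \<mu> m k))\<^sup>2)"
    proof (rule sum.mono_neutral_right)
      show "\<forall>k\<in>{j..} - J. l k * (z k + (\<Sum>m\<in>{k<..}. z m * \<mu> m k))\<^sup>2 = 0"
      proof
        fix k assume "k \<in> {j..} - J"
        then have "i < k" by (auto simp: J_def)
        then have "k \<notin> J" and above: "{m\<in>J. k < m} = {}" by (auto simp: J_def)
        then have "z k = 0" using z(2) by auto
        then show "l k * (z k + (\<Sum>m\<in>{k<..}. z m * \<mu> m k))\<^sup>2 = 0"
          unfolding sums above by simp
      qed
    qed (auto simp: J_def)
    also have "\<dots> \<le> (\<Sum>k\<in>J. s\<^sup>2)"
    proof (rule sum_mono)
      fix k assume k: "k \<in> J"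
      have "l k * (z k + (\<Sum>m\<in>{k<..}. z m * \<mu> m k))\<^sup>2
         = (\<bar>z k + (\<Sum>m\<in>{m\<in>J. k < m}. z m * \<mu> m k)\<bar> * sqrt (l k))\<^sup>2"
        using l[of k] by (simp add: power_mult_distrib sums)
      also have "\<dots> \<le> s\<^sup>2"
        using z(3)[OF k] l[of k] by (intro power_mono) (auto intro!: mult_nonneg_nonneg)
      finally show "l k * (z k + (\<Sum>m\<in>{k<..}. z m * \<mu> m k))\<^sup>2 \<le> s\<^sup>2" .
    qed
    also have "\<dots> = m * s\<^sup>2" by (simp add: m_def)
    also have "\<dots> = exp (ln (4 * real m) + \<Lambda> / m)"
    proof -
      have "s\<^sup>2 = exp (2 * (ln 2 + \<Lambda> / (2 * m)))"
        unfolding s_def by (simp flip: exp_double)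
      also have "2 * (ln 2 + \<Lambda> / (2 * m)) = ln 4 + \<Lambda> / m"
        using ln_realpow[of 2 2] by (simp add: field_simps)
      finally show ?thesis using m0 by (simp add: exp_add ln_mult)
    qed
    finally have "ln (l j) \<le> ln (exp (ln (4 * real m) + \<Lambda> / m))"
      using l[of j] by (subst ln_le_cancel_iff) auto
    then have "ln (l j) \<le> ln (4 * real m) + \<Lambda> / m" by simp
    also have "\<dots> \<le> c + \<Lambda> / m"
      unfolding c_def using m0 mg by simp
    finally have "m * ln (l j) \<le> m * (c + \<Lambda> / m)"
      by (intro mult_left_mono) auto
    then show ?thesis
      using m0 less_imp_le[OF ji] by (simp add: m_def J_def \<Lambda>_def algebra_simps)
  qed
  have "ln (l j) - ln (l i) \<le> c * (1 + harm (card {j<..i}))"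
    using avg c ji by (rule segment_averages_imp_harmonic_bound)
  also have "\<dots> \<le> c * (2 + ln (real g))"
  proof (intro mult_left_mono c)
    have "card {j<..i} > 0" using ji by (auto simp: card_gt_0_iff)
    moreover have "card {j<..i} \<le> g" unfolding g_def by (rule card_mono) auto
    ultimately have "harm (card {j<..i}) \<le> 1 + ln (real g)"
      using harm_le_1_plus_ln[of "card {j<..i}"] by (smt (verit) ln_le_cancel_iff of_nat_0_less_iff of_nat_mono)
    then show "1 + harm (card {j<..i}) \<le> 2 + ln (real g)" by simp
  qed
  finally have "exp (ln (l j)) \<le> exp (c * (2 + ln (real g)) + ln (l i))"
    by simp
  then show ?thesis
    using l by (simp add: exp_add hkz_factor_def c_def g_def)
qed

section \<open>Reduced matrices\<close>

lemma gs_proj_eqI: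
  assumes "p \<in> span (b ` {..<i})" "\<And>j. j < i \<Longrightarrow> q \<bullet> b j = 0" "x = p + q"
  shows "gs_proj b i x = q"
proof -
  let ?S = "span (b ` {..<i})"
  have orth: "q \<bullet> z = 0" if "z \<in> ?S" for z
  proof -
    have "orthogonal q z"
      using assms(2) by (intro orthogonal_to_span[OF that]) (auto simp: orthogonal_def)
    then show ?thesis by (simp add: orthogonal_def)
  qed
  have "p = closest_point ?S x"
  proof (rule closest_point_unique)
    show "\<forall>z\<in>?S. dist x p \<le> dist x z"
    proof
      fix z assume z: "z \<in> ?S"
      have "q \<bullet> (p - z) = 0" using assms(1) z by (intro orth span_diff)
      then have "norm q ^ 2 \<le> norm (q + (p - z)) ^ 2"
        by (simp add: power2_norm_eq_inner inner_add_left inner_add_right inner_commute)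
      then have "norm q \<le> norm (q + (p - z))"
        by (rule power2_le_imp_le) simp
      then show "dist x p \<le> dist x z"
        by (simp add: dist_norm assms(3) algebra_simps)
    qed
  qed (use assms(1) in \<open>auto intro: subspace_imp_convex closed_subspace subspace_span\<close>)
  then show ?thesis by (simp add: gs_proj_def assms(3))
qed

lemma gs_proj_residual: "x - gs_proj b i x \<in> span (b ` {..<i})"
  unfolding gs_proj_def
  using closest_point_in_set[OF closed_subspace[OF subspace_span]] span_0 by fastforce

lemma gs_proj_orthogonal:
  assumes "j < i"
  shows "gs_proj b i x \<bullet> b j = 0"
proof -
  let ?S = "span (b ` {..<i})"
  define p where "p = closest_point ?S x"
  have p: "p \<in> ?S"
    using gs_proj_residual[of x b i] by (simp add: gs_proj_def p_def)
  have bj: "b j \<in> ?S" using assms by (intro span_base) auto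
  have dot: "(x - p) \<bullet> (z - p) \<le> 0" if "z \<in> ?S" for z
    unfolding p_def
    using that by (intro closest_point_dot subspace_imp_convex closed_subspace subspace_span)
  from dot[OF span_add[OF p bj]] dot[OF span_diff[OF p bj]]
  have "(x - p) \<bullet> b j = 0" by (simp add: inner_diff_right)
  then show ?thesis by (simp add: gs_proj_def p_def)
qed

definition gs_vec :: "('g::{finite,linorder} \<Rightarrow> (real, 'g) vec) \<Rightarrow> 'g \<Rightarrow> (real, 'g) vec" where
  "gs_vec b i = gs_proj b i (b i)"

lemma gs_vec_orthogonal_basis: "j < i \<Longrightarrow> b j \<bullet> gs_vec b i = 0"
  by (metis gs_vec_def gs_proj_orthogonal inner_commute)

lemma gs_vec_orthogonal_span:
  assumes "x \<in> span (b ` {..<i})"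
  shows "x \<bullet> gs_vec b i = 0"
proof -
  have "orthogonal (gs_vec b i) x"
    using gs_vec_orthogonal_basis[of _ i b]
    by (intro orthogonal_to_span[OF assms]) (auto simp: orthogonal_def inner_commute)
  then show ?thesis by (simp add: orthogonal_def inner_commute)
qed

lemma gs_vec_in_span: "gs_vec b i \<in> span (b ` {..i})"
proof -
  have "span (b ` {..<i}) \<subseteq> span (b ` {..i})" by (intro span_mono) auto
  with gs_proj_residual[of "b i" b i] have "b i - gs_vec b i \<in> span (b ` {..i})"
    unfolding gs_vec_def by blast
  moreover have "b i \<in> span (b ` {..i})" by (rule span_base) simp
  ultimately have "b i - (b i - gs_vec b i) \<in> span (b ` {..i})" by (metis span_diff)
  then show ?thesis by simp
qed

lemma gs_vec_orthogonal:
  assumes "i \<noteq> j"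
  shows "gs_vec b i \<bullet> gs_vec b j = 0"
proof -
  have *: "gs_vec b i \<bullet> gs_vec b j = 0" if "i < j" for i j
  proof (rule gs_vec_orthogonal_span)
    have "span (b ` {..i}) \<subseteq> span (b ` {..<j})" using that by (intro span_mono) auto
    then show "gs_vec b i \<in> span (b ` {..<j})" using gs_vec_in_span[of b i] by blast
  qed
  show ?thesis
    using assms *[of i j] *[of j i] by (auto simp: neq_iff inner_commute)
qed

lemma basis_dot_gs_vec: "b i \<bullet> gs_vec b i = gs_vec b i \<bullet> gs_vec b i"
  using gs_vec_orthogonal_span[OF gs_proj_residual[of "b i" b i]]
  by (simp add: gs_vec_def[symmetric] inner_diff_left)

lemma gs_vec_nonzero:
  assumes "inj b" "independent (range b)"
  shows "gs_vec b i \<noteq> 0"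
proof
  assume "gs_vec b i = 0"
  then have "b i \<in> span (b ` {..<i})"
    using gs_proj_residual[of "b i" b i] by (simp add: gs_vec_def)
  also have "\<dots> \<subseteq> span (range b - {b i})"
    using assms(1) by (intro span_mono) (auto simp: inj_def)
  finally show False
    using assms(2) by (auto simp: dependent_def)
qed

text \<open>The Gram--Schmidt vectors are g nonzero orthogonal vectors and therefore span the space.
  The residual is orthogonal to all of them, hence to itself.\<close>

lemma gs_expansion:
  fixes b :: "'g::{finite,linorder} \<Rightarrow> (real, 'g) vec"
  assumes "inj b" "independent (range b)"
  shows "x = (\<Sum>k\<in>UNIV. (x \<bullet> gs_vec b k / (gs_vec b k \<bullet> gs_vec b k)) *\<^sub>R gs_vec b k)"
proof -
  define y where "y = x - (\<Sum>k\<in>UNIV. (x \<bullet> gs_vec b k / (gs_vec b k \<bullet> gs_vec b k)) *\<^sub>R gs_vec b k)"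
  have nz: "gs_vec b k \<bullet> gs_vec b k \<noteq> 0" for k
    using gs_vec_nonzero[OF assms] by simp
  have y: "y \<bullet> gs_vec b k = 0" for k
  proof -
    have "(\<Sum>j\<in>UNIV. (x \<bullet> gs_vec b j / (gs_vec b j \<bullet> gs_vec b j)) * (gs_vec b j \<bullet> gs_vec b k))
       = (\<Sum>j\<in>{k}. (x \<bullet> gs_vec b j / (gs_vec b j \<bullet> gs_vec b j)) * (gs_vec b j \<bullet> gs_vec b k))"
      by (rule sum.mono_neutral_right) (auto simp: gs_vec_orthogonal)
    then show ?thesis
      using nz[of k] by (simp add: y_def inner_diff_left inner_sum_left)
  qed
  have "pairwise orthogonal (range (gs_vec b))"
    unfolding pairwise_def orthogonal_def by (auto intro!: gs_vec_orthogonal)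
  moreover have "0 \<notin> range (gs_vec b)"
    using gs_vec_nonzero[OF assms] by force
  ultimately have "independent (range (gs_vec b))"
    by (rule pairwise_orthogonal_independent)
  moreover have "inj (gs_vec b)"
  proof (rule injI, rule ccontr)
    fix i j assume "gs_vec b i = gs_vec b j" "i \<noteq> j"
    then show False using gs_vec_orthogonal[of i j b] nz[of i] by simp
  qed
  then have "card (range (gs_vec b)) = CARD('g)" by (rule card_image)
  ultimately have "UNIV \<subseteq> span (range (gs_vec b))"
    by (intro card_ge_dim_independent) auto
  then have "y \<in> span (range (gs_vec b))" by blast
  then have "orthogonal y y"
    by (rule orthogonal_to_span) (use y in \<open>auto simp: orthogonal_def\<close>)
  then show ?thesis by (simp add: orthogonal_def y_def)
qed

lemma inner_gs_expansion:
  fixes b :: "'g::{finite,linorder} \<Rightarrow> (real, 'g) vec"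
  assumes "inj b" "independent (range b)"
  shows "x \<bullet> y = (\<Sum>k\<in>UNIV. (x \<bullet> gs_vec b k) * (y \<bullet> gs_vec b k) / (gs_vec b k \<bullet> gs_vec b k))"
  by (subst gs_expansion[OF assms, of y]) (simp add: inner_sum_right mult_ac)

text \<open>The expansion splits at j: the terms before j lie in the span that the projection
  removes, the others are orthogonal to it.\<close>

lemma norm_gs_proj:
  fixes b :: "'g::{finite,linorder} \<Rightarrow> (real, 'g) vec"
  assumes "inj b" "independent (range b)"
  shows "(norm (gs_proj b j x))\<^sup>2 = (\<Sum>k\<in>{j..}. (x \<bullet> gs_vec b k)\<^sup>2 / (gs_vec b k \<bullet> gs_vec b k))"
proof -
  define coef where "coef k = x \<bullet> gs_vec b k / (gs_vec b k \<bullet> gs_vec b k)" for k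
  have nz: "gs_vec b k \<bullet> gs_vec b k \<noteq> 0" for k
    using gs_vec_nonzero[OF assms] by simp
  define p where "p = (\<Sum>k\<in>{..<j}. coef k *\<^sub>R gs_vec b k)"
  define q where "q = (\<Sum>k\<in>{j..}. coef k *\<^sub>R gs_vec b k)"
  have "gs_proj b j x = q"
  proof (rule gs_proj_eqI)
    show "p \<in> span (b ` {..<j})"
      unfolding p_def
    proof (intro span_sum span_scale)
      fix k assume "k \<in> {..<j}"
      then have "span (b ` {..k}) \<subseteq> span (b ` {..<j})" by (intro span_mono) auto
      then show "gs_vec b k \<in> span (b ` {..<j})" using gs_vec_in_span by blast
    qed
    show "q \<bullet> b i = 0" if "i < j" for i
      unfolding q_def inner_sum_left using that
      by (intro sum.neutral) (auto simp: gs_vec_orthogonal_basis inner_commute)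
    have "UNIV = {..<j} \<union> {j..}" by auto
    then have "p + q = (\<Sum>k\<in>UNIV. coef k *\<^sub>R gs_vec b k)"
      unfolding p_def q_def by (subst sum.union_disjoint[symmetric]) auto
    then show "x = p + q"
      using gs_expansion[OF assms, of x] by (simp add: coef_def)
  qed
  moreover have "q \<bullet> gs_vec b k = (if j \<le> k then x \<bullet> gs_vec b k else 0)" for k
  proof -
    have "q \<bullet> gs_vec b k = (\<Sum>i\<in>{j..}. if i = k then coef k * (gs_vec b k \<bullet> gs_vec b k) else 0)"
      unfolding q_def inner_sum_left by (intro sum.cong) (auto simp: gs_vec_orthogonal)
    then show ?thesis using nz[of k] by (simp add: coef_def)
  qed
  then have "q \<bullet> q = (\<Sum>k\<in>{j..}. (x \<bullet> gs_vec b k)\<^sup>2 / (gs_vec b k \<bullet> gs_vec b k))"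
    by (subst inner_gs_expansion[OF assms])
      (auto simp: power2_eq_square intro!: sum.mono_neutral_cong_right split: if_splits)
  ultimately show ?thesis by (simp add: power2_norm_eq_inner)
qed

text \<open>The vector \<open>s\<close> collects the inner products with the Gram--Schmidt vectors, and \<open>S *v w = x\<close>
  avoids naming the inverse of the Gram matrix.\<close>
lemma hkz_reduced_coordinates:
  fixes S :: "((real, 'g::{finite,linorder}) vec, 'g) vec"
  assumes hkz: "hkz_reduced S"
  obtains l :: "'g \<Rightarrow> real" and \<mu> :: "'g \<Rightarrow> 'g \<Rightarrow> real"
  where "\<And>k. 0 < l k" "\<And>i j. j < i \<Longrightarrow> \<bar>\<mu> i j\<bar> \<le> 1/2"
    "\<And>i j. j \<le> i \<Longrightarrow> l j \<le> hkz_factor CARD('g) * l i"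
    "\<And>w x s. S *v w = x \<Longrightarrow> (\<And>i. x $ i = s i + (\<Sum>k\<in>{..<i}. \<mu> i k * s k)) \<Longrightarrow>
       x \<bullet> w = (\<Sum>k\<in>UNIV. (s k)\<^sup>2 / l k)"
proof -
  obtain b where "hkz_basis b" and S: "S = (\<chi> i j. b i \<bullet> b j)"
    using hkz by (auto simp: hkz_reduced_def)
  then have b: "inj b" "independent (range b)"
    and size: "\<And>i j. i < j \<Longrightarrow> \<bar>b j \<bullet> gs_vec b i\<bar> \<le> 1/2 * (gs_vec b i \<bullet> gs_vec b i)"
    and short: "\<And>i x. x \<in> lattice_of b \<Longrightarrow> gs_proj b i x \<noteq> 0 \<Longrightarrow> norm (gs_vec b i) \<le> norm (gs_proj b i x)"
    unfolding hkz_basis_def gs_vec_def by auto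
  define l where "l k = gs_vec b k \<bullet> gs_vec b k" for k
  define \<mu> where "\<mu> i k = b i \<bullet> gs_vec b k / l k" for i k
  have l: "0 < l k" for k
    using gs_vec_nonzero[OF b] by (simp add: l_def)
  have \<mu>: "b i \<bullet> gs_vec b k = \<mu> i k * l k" for i k
    using l[of k] by (simp add: \<mu>_def)
  have coord: "(\<Sum>m\<in>UNIV. c m *\<^sub>R b m) \<bullet> gs_vec b k = l k * (c k + (\<Sum>m\<in>{k<..}. c m * \<mu> m k))" for c k
  proof -
    have "(\<Sum>m\<in>UNIV. c m *\<^sub>R b m) \<bullet> gs_vec b k = (\<Sum>m\<in>UNIV. c m * (b m \<bullet> gs_vec b k))"
      by (simp add: inner_sum_left)
    also have "\<dots> = (\<Sum>m\<in>insert k {k<..}. c m * (b m \<bullet> gs_vec b k))"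
      by (rule sum.mono_neutral_right) (auto simp: not_less gs_vec_orthogonal_basis)
    also have "\<dots> = c k * l k + (\<Sum>m\<in>{k<..}. c m * (\<mu> m k * l k))"
      by (simp add: \<mu>[symmetric]) (simp add: basis_dot_gs_vec l_def)
    finally show ?thesis
      by (simp add: sum_distrib_left distrib_left mult_ac)
  qed
  have prof: "l j \<le> hkz_factor CARD('g) * l i" if "j \<le> i" for i j
  proof (rule hkz_profile[where l = l and \<mu> = \<mu>, OF l _ that])
    fix c :: "'g \<Rightarrow> int" and j
    assume c: "\<exists>k\<ge>j. c k \<noteq> 0"
    define x where "x = (\<Sum>m\<in>UNIV. of_int (c m) *\<^sub>R b m)"
    \<comment> \<open>At the last nonzero coefficient the Gram--Schmidt coordinate, in units of the
      Gram--Schmidt vector, is that integer itself. So the projection is nonzero and the minimality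
      condition applies to x.\<close>
    define k where "k = Max {k. c k \<noteq> 0}"
    have "{k. c k \<noteq> 0} \<noteq> {}" using c by auto
    from Max_in[OF _ this] have ck: "c k \<noteq> 0" by (simp add: k_def)
    have "m \<le> k" if "c m \<noteq> 0" for m using that by (simp add: k_def)
    then have above: "c m = 0" if "k < m" for m using that by (metis not_le)
    have jk: "j \<le> k" using c \<open>\<And>m. c m \<noteq> 0 \<Longrightarrow> m \<le> k\<close> by (meson order_trans)
    have proj: "(norm (gs_proj b j x))\<^sup>2 = (\<Sum>k\<in>{j..}. l k * (c k + (\<Sum>m\<in>{k<..}. c m * \<mu> m k))\<^sup>2)"
      unfolding norm_gs_proj[OF b] x_def coord l_def[symmetric]
      using l by (intro sum.cong) (auto simp: power_mult_distrib power2_eq_square less_imp_neq[symmetric])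
    have "(\<Sum>m\<in>{k<..}. c m * \<mu> m k) = 0"
      by (rule sum.neutral) (auto simp: above)
    then have "0 < l k * (c k + (\<Sum>m\<in>{k<..}. c m * \<mu> m k))\<^sup>2"
      using ck l[of k] by simp
    also have "\<dots> \<le> (norm (gs_proj b j x))\<^sup>2"
      unfolding proj using jk l
      by (intro member_le_sum) (auto intro!: mult_nonneg_nonneg intro: less_imp_le)
    finally have "gs_proj b j x \<noteq> 0" by auto
    moreover have "x \<in> lattice_of b"
      unfolding lattice_of_def x_def by blast
    ultimately have "(norm (gs_vec b j))\<^sup>2 \<le> (norm (gs_proj b j x))\<^sup>2"
      by (intro power_mono short) auto
    then show "l j \<le> (\<Sum>k\<in>{j..}. l k * (c k + (\<Sum>m\<in>{k<..}. c m * \<mu> m k))\<^sup>2)"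
      unfolding proj by (simp add: l_def power2_norm_eq_inner)
  qed
  show ?thesis
  proof
    show "0 < l k" for k by (rule l)
    show "\<bar>\<mu> i j\<bar> \<le> 1/2" if "j < i" for i j
      using size[OF that] l[of j] by (simp add: \<mu>_def l_def field_simps)
    show "l j \<le> hkz_factor CARD('g) * l i" if "j \<le> i" for i j
      using that by (rule prof)
    fix w x s
    assume x: "S *v w = x" and s: "\<And>i. x $ i = s i + (\<Sum>k\<in>{..<i}. \<mu> i k * s k)"
    \<comment> \<open>The Gram matrix sends the coefficients w of a vector p to its inner products x
      with the basis, so \<open>x \<bullet> w\<close> is the squared length of p.\<close>
    define p where "p = (\<Sum>j\<in>UNIV. (w $ j) *\<^sub>R b j)"
    have pb: "p \<bullet> b i = x $ i" for i
      by (simp add: x[symmetric] S p_def matrix_vector_mult_def inner_sum_left inner_sum_right inner_commute mult_ac)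
    have "p \<bullet> p = (\<Sum>j\<in>UNIV. w $ j * x $ j)"
      by (subst (2) p_def) (simp only: inner_sum_right inner_scaleR_right pb)
    also have "\<dots> = x \<bullet> w" by (simp add: inner_vec_def mult.commute)
    finally have pp: "x \<bullet> w = p \<bullet> p" by (rule sym)
    define s' where "s' k = p \<bullet> gs_vec b k" for k
    have s': "x $ i = s' i + (\<Sum>k\<in>{..<i}. \<mu> i k * s' k)" for i
    proof -
      have "x $ i = (\<Sum>k\<in>UNIV. s' k * (b i \<bullet> gs_vec b k) / l k)"
        unfolding pb[symmetric] s'_def l_def by (rule inner_gs_expansion[OF b])
      also have "\<dots> = (\<Sum>k\<in>insert i {..<i}. s' k * (b i \<bullet> gs_vec b k) / l k)"
        by (rule sum.mono_neutral_right) (auto simp: not_less gs_vec_orthogonal_basis)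
      also have "\<dots> = s' i + (\<Sum>k\<in>{..<i}. \<mu> i k * s' k)"
        using l[of i] by (simp add: basis_dot_gs_vec l_def[symmetric]) (simp add: \<mu>_def mult_ac)
      finally show ?thesis .
    qed
    \<comment> \<open>A unit triangular system has one solution, which identifies the given s with
      the inner products of p and the Gram--Schmidt vectors.\<close>
    have "s' k = s k" for k
    proof (induction k rule: wf_induct_rule[OF wf_less_finite])
      case (1 i)
      then have "(\<Sum>k\<in>{..<i}. \<mu> i k * s' k) = (\<Sum>k\<in>{..<i}. \<mu> i k * s k)"
        by (intro sum.cong) auto
      then show ?case using s[of i] s'[of i] by simp
    qed
    then have "p \<bullet> gs_vec b k = s k" for k by (simp add: s'_def)
    then show "x \<bullet> w = (\<Sum>k\<in>UNIV. (s k)\<^sup>2 / l k)"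
      unfolding pp by (subst inner_gs_expansion[OF b]) (simp add: l_def power2_eq_square)
  qed
qed

text \<open>The ranks from below and from above add up to \<open>CARD('g) - 1\<close>, so both are
  bijections onto the same initial segment. \<sigma> matches one with the other, and the symmetry of
  the sum makes it an involution.\<close>

lemma rev_mat_permutation:
  obtains \<sigma> :: "'g::{finite,linorder} \<Rightarrow> 'g"
  where "\<And>i. \<sigma> (\<sigma> i) = i" "\<And>x i. (rev_mat *v x) $ i = x $ \<sigma> i"
proof -
  define f where "f i = card {..<i}" for i :: 'g
  define h where "h i = card {i<..}" for i :: 'g
  have fh: "f i + h i + 1 = CARD('g)" for i
  proof -
    have "UNIV = insert i ({..<i} \<union> {i<..})" by auto
    then have "CARD('g) = card (insert i ({..<i} \<union> {i<..}))" by metis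
    also have "\<dots> = f i + h i + 1"
      unfolding f_def h_def by (subst card_insert_disjoint) (auto intro!: card_Un_disjoint)
    finally show ?thesis by simp
  qed
  have mono: "f i < f j" if "i < j" for i j
    unfolding f_def using that by (intro psubset_card_mono) auto
  have "inj f" by (rule injI) (metis mono less_irrefl neq_iff)
  then have "inj h"
    using fh by (intro injI) (metis add_right_cancel add_left_cancel injD)
  have surj: "range h = {..<CARD('g)}"
  proof (rule card_subset_eq)
    show "range h \<subseteq> {..<CARD('g)}"
    proof clarsimp
      fix i show "h i < CARD('g)" using fh[of i] by simp
    qed
    show "card (range h) = card {..<CARD('g)}"
      using \<open>inj h\<close> by (simp add: card_image)
  qed simp
  have "\<exists>j. h j = f i" for i
  proof -
    have "f i \<in> range h" unfolding surj using fh[of i] by simp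
    then show ?thesis by (metis imageE)
  qed
  then obtain \<sigma> where \<sigma>: "\<And>i. h (\<sigma> i) = f i" by metis
  have *: "card {..<i} = card {j<..} \<longleftrightarrow> j = \<sigma> i" for i j
    using \<sigma>[of i] \<open>inj h\<close> by (auto simp: f_def h_def inj_def)
  show ?thesis
  proof
    fix i
    have "f (\<sigma> i) = h i" using fh[of i] fh[of "\<sigma> i"] \<sigma>[of i] by simp
    then show "\<sigma> (\<sigma> i) = i" using *[of "\<sigma> i" i] by (simp add: f_def h_def)
    fix x :: "(real, 'g) vec"
    have "(rev_mat *v x) $ i = (\<Sum>j\<in>UNIV. if j = \<sigma> i then x $ j else 0)"
      unfolding matrix_vector_mult_def rev_mat_def by (simp add: * if_distrib if_distribR cong: if_cong)
    then show "(rev_mat *v x) $ i = x $ \<sigma> i" by simp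
  qed
qed

lemma invertible_pos_def:
  fixes Y :: "real ^ 'g ^ 'g"
  assumes "\<And>x. x \<noteq> 0 \<Longrightarrow> x \<bullet> (Y *v x) > 0"
  shows "invertible Y"
proof -
  have "x = 0" if "Y *v x = 0" for x
    using assms[of x] that by fastforce
  then show ?thesis
    by (simp add: invertible_left_inverse matrix_left_invertible_ker)
qed

lemma matrix_inv_inverse:
  fixes A :: "real ^ 'g ^ 'g"
  assumes "invertible A"
  shows "A ** matrix_inv A = mat 1" "matrix_inv A ** A = mat 1"
  using someI_ex[OF assms[unfolded invertible_def]] unfolding matrix_inv_def by auto

lemma siegel_invertible: "\<tau> \<in> siegel \<Longrightarrow> invertible (Im_mat \<tau>)"
  by (rule invertible_pos_def) (auto simp: siegel_def)

text \<open>The reduced basis belongs to the inverse of the imaginary part, so its Gram--Schmidt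
  lengths enter the form itself through reciprocals, and upper bounds for l are lower bounds for the
  form. The minimum condition bounds the last l; the profile carries this to the others.\<close>

lemma reduced_matrix_coordinates:
  fixes \<tau> :: "((complex, 'g::{finite,linorder}) vec, 'g) vec"
  assumes "reduced_matrix \<tau>"
  obtains l :: "'g \<Rightarrow> real" and \<mu> :: "'g \<Rightarrow> 'g \<Rightarrow> real" and \<sigma> :: "'g \<Rightarrow> 'g"
  where "\<And>k. 0 < l k" "\<And>i j. j < i \<Longrightarrow> \<bar>\<mu> i j\<bar> \<le> 1/2" "\<And>i. \<sigma> (\<sigma> i) = i"
    "\<And>i j. j \<le> i \<Longrightarrow> l j \<le> hkz_factor CARD('g) * l i"
    "\<And>i. l i \<le> hkz_factor CARD('g) * (2 / sqrt 3)"
    "\<And>x s. (\<And>i. x $ \<sigma> i = s i + (\<Sum>k\<in>{..<i}. \<mu> i k * s k)) \<Longrightarrow>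
       x \<bullet> (Im_mat \<tau> *v x) = (\<Sum>k\<in>UNIV. (s k)\<^sup>2 / l k)"
proof -
  define Y where "Y = Im_mat \<tau>"
  define P where "P = (rev_mat :: ((real, 'g) vec, 'g) vec)"
  have \<tau>: "\<tau> \<in> siegel" and hkz: "hkz_reduced (P ** matrix_inv Y ** P)"
    and min: "\<And>n. n \<in> int_vecs \<Longrightarrow> n \<noteq> 0 \<Longrightarrow> n \<bullet> (Y *v n) \<ge> sqrt 3 / 2"
    using assms by (auto simp: reduced_matrix_def reciprocal_hkz_reduced_def Y_def P_def)
  have inv: "matrix_inv Y ** Y = mat 1"
    using siegel_invertible[OF \<tau>] by (simp add: Y_def matrix_inv_inverse)
  obtain \<sigma> :: "'g \<Rightarrow> 'g" where \<sigma>: "\<And>i. \<sigma> (\<sigma> i) = i" and P: "\<And>x i. (P *v x) $ i = x $ \<sigma> i"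
    unfolding P_def using rev_mat_permutation by blast
  have bij: "bij \<sigma>" using \<sigma> by (rule involuntory_imp_bij)
  have PP: "P *v (P *v x) = x" for x
    by (simp add: vec_eq_iff P \<sigma>)
  have Pdot: "(P *v x) \<bullet> (P *v y) = x \<bullet> y" for x y
    unfolding inner_vec_def P
    using sum.reindex_bij_betw[OF bij, of "\<lambda>i. x $ i \<bullet> y $ i"] by simp
  obtain l \<mu> where l: "\<And>k. 0 < l k" and \<mu>: "\<And>i j. j < i \<Longrightarrow> \<bar>\<mu> i j\<bar> \<le> 1/2"
    and prof: "\<And>i j. j \<le> i \<Longrightarrow> l j \<le> hkz_factor CARD('g) * l i"
    and form: "\<And>w x s. (P ** matrix_inv Y ** P) *v w = x \<Longrightarrow>
       (\<And>i. x $ i = s i + (\<Sum>k\<in>{..<i}. \<mu> i k * s k)) \<Longrightarrow> x \<bullet> w = (\<Sum>k\<in>UNIV. (s k)\<^sup>2 / l k)"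
    using hkz_reduced_coordinates[OF hkz] by blast
  have quad: "x \<bullet> (Y *v x) = (\<Sum>k\<in>UNIV. (s k)\<^sup>2 / l k)"
    if "\<And>i. x $ \<sigma> i = s i + (\<Sum>k\<in>{..<i}. \<mu> i k * s k)" for x s
  proof -
    \<comment> \<open>For \<open>w = P *v (Y *v x)\<close> the reversed inverse gives back
      \<open>P *v x\<close>, and \<open>x \<bullet> w\<close> of the previous lemma becomes the form
      of Y at x.\<close>
    have "(P ** matrix_inv Y ** P) *v (P *v (Y *v x)) = P *v ((matrix_inv Y ** Y) *v x)"
      by (simp add: matrix_vector_mul_assoc[symmetric] PP)
    then have "(P ** matrix_inv Y ** P) *v (P *v (Y *v x)) = P *v x"
      by (simp add: inv)
    from form[OF this, of s] that show ?thesis by (simp add: P Pdot)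
  qed
  define m :: 'g where "m = Max UNIV"
  have m: "i \<le> m" for i by (simp add: m_def)
  \<comment> \<open>At the largest index a unit vector has a single nonzero Gram--Schmidt
    coordinate, since no later coordinate has to correct for it. The form there is
    \<open>1 / l m\<close>.\<close>
  have "sqrt 3 / 2 \<le> axis (\<sigma> m) 1 \<bullet> (Y *v axis (\<sigma> m) 1)"
    by (rule min) (auto simp: int_vecs_def axis_eq_0_iff, simp add: axis_def)
  also have "\<dots> = (\<Sum>k\<in>UNIV. (if k = m then 1 else 0)\<^sup>2 / l k)"
  proof (rule quad)
    fix i
    have "(\<Sum>k\<in>{..<i}. \<mu> i k * (if k = m then 1 else 0)) = 0"
      using m[of i] by (intro sum.neutral) auto
    moreover have "\<sigma> i = \<sigma> m \<longleftrightarrow> i = m" using \<sigma> by metis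
    ultimately show "axis (\<sigma> m) 1 $ \<sigma> i = (if i = m then 1 else 0) + (\<Sum>k\<in>{..<i}. \<mu> i k * (if k = m then 1 else 0))"
      by (auto simp: axis_def)
  qed
  also have "\<dots> = (\<Sum>k\<in>UNIV. if k = m then 1 / l k else 0)"
    by (intro sum.cong) auto
  finally have "l m \<le> 2 / sqrt 3"
    using l[of m] by (simp add: field_simps)
  then have "hkz_factor CARD('g) * l m \<le> hkz_factor CARD('g) * (2 / sqrt 3)"
    by (intro mult_left_mono) (auto simp: hkz_factor_def)
  then have last: "l i \<le> hkz_factor CARD('g) * (2 / sqrt 3)" for i
    using prof[OF m] order_trans by blast
  show ?thesis
    by (rule that[of l \<mu> \<sigma>, OF l \<mu> \<sigma> prof last quad[unfolded Y_def]])
qed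

section \<open>Excess over the distance to the shifted lattice\<close>

lemma norm_tau_nonneg:
  assumes "\<tau> \<in> siegel"
  shows "0 \<le> pi * (x \<bullet> (Im_mat \<tau> *v x))" "0 \<le> norm_tau \<tau> x"
    "(norm_tau \<tau> x)\<^sup>2 = pi * (x \<bullet> (Im_mat \<tau> *v x))"
proof -
  have "0 \<le> x \<bullet> (Im_mat \<tau> *v x)"
    using assms by (cases "x = 0") (auto simp: siegel_def intro: less_imp_le)
  then show *: "0 \<le> pi * (x \<bullet> (Im_mat \<tau> *v x))" by simp
  then show "0 \<le> norm_tau \<tau> x" "(norm_tau \<tau> x)\<^sup>2 = pi * (x \<bullet> (Im_mat \<tau> *v x))"
    by (auto simp: norm_tau_def)
qed

text \<open>Near-minimisers come from the infimum alone and stand in for a closest point; their use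
  costs a factor of two in the largest coefficient.\<close>

lemma dist_tau_half_shift:
  assumes "\<tau> \<in> siegel"
  shows "0 \<le> dist_tau \<tau> v (half_shift a)"
    and "n \<in> half_shift a \<Longrightarrow> (dist_tau \<tau> v (half_shift a))\<^sup>2 \<le> (norm_tau \<tau> (n - v))\<^sup>2"
    and "0 < e \<Longrightarrow> \<exists>n\<in>half_shift a. (norm_tau \<tau> (n - v))\<^sup>2 < (dist_tau \<tau> v (half_shift a))\<^sup>2 + e"
proof -
  let ?S = "half_shift a" let ?d = "dist_tau \<tau> v ?S"
  have sym: "norm_tau \<tau> (v - s) = norm_tau \<tau> (s - v)" for s
    unfolding norm_tau_def by (simp add: matrix_vector_mult_diff_distrib inner_diff_left inner_diff_right)
  have bdd: "bdd_below ((\<lambda>s. norm_tau \<tau> (v - s)) ` ?S)"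
    using norm_tau_nonneg[OF assms] by (intro bdd_belowI2[of _ 0]) auto
  have ne: "?S \<noteq> {}"
    by (auto simp: half_shift_def int_vecs_def intro!: exI[of _ "0 :: real ^ 'a"])
  show d0: "0 \<le> ?d"
    unfolding dist_tau_def using ne norm_tau_nonneg[OF assms] by (intro cINF_greatest) auto
  show "?d\<^sup>2 \<le> (norm_tau \<tau> (n - v))\<^sup>2" if "n \<in> ?S"
  proof (rule power_mono[OF _ d0])
    show "?d \<le> norm_tau \<tau> (n - v)"
      unfolding dist_tau_def sym[symmetric] by (rule cINF_lower[OF bdd that])
  qed
  show "\<exists>n\<in>?S. (norm_tau \<tau> (n - v))\<^sup>2 < ?d\<^sup>2 + e" if "0 < e"
  proof -
    have "?d < sqrt (?d\<^sup>2 + e)"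
      using that d0 by (intro real_less_rsqrt) auto
    then obtain n where n: "n \<in> ?S" "norm_tau \<tau> (v - n) < sqrt (?d\<^sup>2 + e)"
      unfolding dist_tau_def using cINF_less_iff[OF ne bdd] by blast
    have "(norm_tau \<tau> (n - v))\<^sup>2 < (sqrt (?d\<^sup>2 + e))\<^sup>2"
      using n(2) norm_tau_nonneg[OF assms] by (intro power_strict_mono) (auto simp: sym)
    then show ?thesis using n(1) that by auto
  qed
qed

text \<open>For a skewed ellipsoid the distance itself can be huge, so only the excess of the squared norm
  over the minimum can control the coordinates. Rounding the trailing Gram--Schmidt coordinates
  (nearest plane) costs at most a quarter of their squared lengths, which are comparable because of
  the profile of the basis.\<close>
lemma coordinate_le_excess:
  fixes \<tau> :: "((complex, 'g::{finite,linorder}) vec, 'g) vec"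
  assumes red: "reduced_matrix \<tau>" and n: "n \<in> half_shift a"
  shows "(n $ i - v $ i)\<^sup>2 \<le> (real CARD('g))\<^sup>2 * hkz_factor CARD('g) *
     (CARD('g) / 4 + 3/8 * ((norm_tau \<tau> (n - v))\<^sup>2 - (dist_tau \<tau> v (half_shift a))\<^sup>2))"
proof -
  define Q where "Q = hkz_factor CARD('g)"
  define E where "E = (norm_tau \<tau> (n - v))\<^sup>2 - (dist_tau \<tau> v (half_shift a))\<^sup>2"
  have \<tau>: "\<tau> \<in> siegel" using red by (simp add: reduced_matrix_def)
  have Q0: "Q > 0" by (simp add: Q_def hkz_factor_def)
  have E0: "E \<ge> 0" using dist_tau_half_shift(2)[OF \<tau> n] by (simp add: E_def)
  obtain l \<mu> \<sigma> where l: "\<And>k. 0 < l k" and \<mu>: "\<And>i j. j < i \<Longrightarrow> \<bar>\<mu> i j\<bar> \<le> 1/2"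
    and \<sigma>: "\<And>i. \<sigma> (\<sigma> i) = i"
    and prof: "\<And>i j. j \<le> i \<Longrightarrow> l j \<le> Q * l i" "\<And>i. l i \<le> Q * (2 / sqrt 3)"
    and quad: "\<And>x s. (\<And>i. x $ \<sigma> i = s i + (\<Sum>k\<in>{..<i}. \<mu> i k * s k)) \<Longrightarrow>
       x \<bullet> (Im_mat \<tau> *v x) = (\<Sum>k\<in>UNIV. (s k)\<^sup>2 / l k)"
    using reduced_matrix_coordinates[OF red, folded Q_def] by blast
  define x where "x = n - v"
  have "\<exists>s. \<forall>i. s i = x $ \<sigma> i - (\<Sum>k\<in>{..<i}. \<mu> i k * s k)"
    by (rule dependent_wf_choice[OF wf_less_finite]) (auto intro: sum.cong)
  then obtain s where s: "\<And>i. x $ \<sigma> i = s i + (\<Sum>k\<in>{..<i}. \<mu> i k * s k)"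
    by (metis diff_add_cancel)
  have s_bound: "(s i)\<^sup>2 \<le> Q * (CARD('g) / 4 + 3/8 * E)" for i
  proof -
    \<comment> \<open>Coordinates before i are kept; from i on, each is moved by an integer into
      [-1/2, 1/2], given the choices already made.\<close>
    define R where "R f j r \<longleftrightarrow> (if j < i then r = s j
        else \<bar>r\<bar> \<le> 1/2 \<and> r - x $ \<sigma> j + (\<Sum>k\<in>{..<j}. \<mu> j k * f k) \<in> \<int>)"
      for f :: "'g \<Rightarrow> real" and j r
    have "\<exists>s'. \<forall>j. R s' j (s' j)"
    proof (rule dependent_wf_choice[OF wf_less_finite])
      fix f h :: "'g \<Rightarrow> real" and j r
      assume "\<And>z. (z, j) \<in> {(m, k). m < k} \<Longrightarrow> f z = h z"
      then have "(\<Sum>k\<in>{..<j}. \<mu> j k * f k) = (\<Sum>k\<in>{..<j}. \<mu> j k * h k)"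
        by (intro sum.cong) auto
      then show "R f j r = R h j r" by (simp add: R_def)
    next
      fix j and f :: "'g \<Rightarrow> real"
      let ?u = "x $ \<sigma> j - (\<Sum>k\<in>{..<j}. \<mu> j k * f k)"
      have "\<bar>?u - of_int (round ?u)\<bar> \<le> 1/2"
        using of_int_round_abs_le[of ?u] by (simp add: abs_minus_commute)
      then have "R f j (if j < i then s j else ?u - of_int (round ?u))"
        by (simp add: R_def)
      then show "\<exists>r. R f j r" by blast
    qed
    then obtain s' where s': "\<And>j. R s' j (s' j)" by blast
    have low: "s' j = s j" if "j < i" for j using s'[of j] that by (simp add: R_def)
    have high: "\<bar>s' j\<bar> \<le> 1/2" "s' j - x $ \<sigma> j + (\<Sum>k\<in>{..<j}. \<mu> j k * s' k) \<in> \<int>" if "i \<le> j" for j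
      using s'[of j] that by (simp_all add: R_def leD)
    define x' where "x' = (\<chi> j. s' (\<sigma> j) + (\<Sum>k\<in>{..<\<sigma> j}. \<mu> (\<sigma> j) k * s' k))"
    have x': "x' $ \<sigma> j = s' j + (\<Sum>k\<in>{..<j}. \<mu> j k * s' k)" for j
      by (simp add: x'_def \<sigma>)
    have int: "x' $ \<sigma> j - x $ \<sigma> j \<in> \<int>" for j
    proof (cases "j < i")
      case True
      then have "(\<Sum>k\<in>{..<j}. \<mu> j k * s' k) = (\<Sum>k\<in>{..<j}. \<mu> j k * s k)"
        by (intro sum.cong) (auto simp: low)
      then have "x' $ \<sigma> j = x $ \<sigma> j" using True by (simp add: x' s low)
      then show ?thesis by simp
    next
      case False
      then show ?thesis using high(2)[of j] by (simp add: x' algebra_simps)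
    qed
    have "x' $ j - x $ j \<in> \<int>" for j
      using int[of "\<sigma> j"] by (simp add: \<sigma>)
    then have "x' - x \<in> int_vecs" by (simp add: int_vecs_def)
    moreover obtain m where m: "m \<in> int_vecs" "n = m + (1/2) *\<^sub>R a"
      using n by (auto simp: half_shift_def)
    ultimately have "m + (x' - x) \<in> int_vecs" by (simp add: int_vecs_def)
    \<comment> \<open>The rounded point competes for the distance, so its form falls below that of x
      by at most the excess E.\<close>
    then have "v + x' \<in> half_shift a"
      unfolding half_shift_def
      by (rule image_eqI[rotated]) (simp add: x_def m(2) algebra_simps)
    then have "(dist_tau \<tau> v (half_shift a))\<^sup>2 \<le> (norm_tau \<tau> x')\<^sup>2"
      using dist_tau_half_shift(2)[OF \<tau>, of "v + x'" a v] by simp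
    also have "\<dots> = pi * (\<Sum>k\<in>UNIV. (s' k)\<^sup>2 / l k)"
      using quad[of x' s', OF x'] by (simp add: norm_tau_nonneg[OF \<tau>])
    finally have "pi * (\<Sum>k\<in>UNIV. (s k)\<^sup>2 / l k) - E \<le> pi * (\<Sum>k\<in>UNIV. (s' k)\<^sup>2 / l k)"
      using quad[of x s, OF s] by (simp add: E_def norm_tau_nonneg[OF \<tau>] x_def)
    then have "(\<Sum>k\<in>UNIV. (s k)\<^sup>2 / l k - (s' k)\<^sup>2 / l k) \<le> E / pi"
      by (simp add: sum_subtractf field_simps)
    \<comment> \<open>Nothing changes before i, the square of \<open>s i\<close> is counted in full,
      and each of the at most g rounded coordinates costs at most
      \<open>(1/4) / l k \<le> Q / (4 * l i)\<close> by the profile.\<close>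
    moreover have "(s i)\<^sup>2 / l i - CARD('g) * (Q / (4 * l i)) \<le> (\<Sum>k\<in>UNIV. (s k)\<^sup>2 / l k - (s' k)\<^sup>2 / l k)"
    proof -
      have "(\<Sum>k\<in>UNIV. (if k = i then (s i)\<^sup>2 / l i else 0) - Q / (4 * l i))
         \<le> (\<Sum>k\<in>UNIV. (s k)\<^sup>2 / l k - (s' k)\<^sup>2 / l k)"
      proof (rule sum_mono)
        fix k
        show "(if k = i then (s i)\<^sup>2 / l i else 0) - Q / (4 * l i) \<le> (s k)\<^sup>2 / l k - (s' k)\<^sup>2 / l k"
        proof (cases "k < i")
          case True
          then have "k \<noteq> i" "s' k = s k" by (auto simp: low)
          then show ?thesis using l[of i] Q0 by simp
        next
          case False
          then have "\<bar>s' k\<bar>\<^sup>2 \<le> (1/2)\<^sup>2"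
            using high(1)[of k] by (intro power_mono) auto
          then have "(s' k)\<^sup>2 \<le> (1/2)\<^sup>2" by simp
          then have "(s' k)\<^sup>2 / l k \<le> (1/4) / l k"
            using l[of k] by (intro divide_right_mono) (auto simp: power2_eq_square)
          also have "\<dots> \<le> Q / (4 * l i)"
            using prof(1)[of i k] False l[of k] l[of i] by (simp add: field_simps)
          finally have "(s' k)\<^sup>2 / l k \<le> Q / (4 * l i)" .
          moreover have "(if k = i then (s i)\<^sup>2 / l i else 0) \<le> (s k)\<^sup>2 / l k"
            using l[of k] by simp
          ultimately show ?thesis by linarith
        qed
      qed
      then show ?thesis by (simp add: sum_subtractf)
    qed
    ultimately have "(s i)\<^sup>2 / l i \<le> CARD('g) * (Q / (4 * l i)) + E / pi" by linarith
    then have "(s i)\<^sup>2 \<le> Q * (CARD('g) / 4) + l i * (E / pi)"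
      using l[of i] by (simp add: field_simps)
    \<comment> \<open>The absolute bound on \<open>l i\<close> enters here because the excess,
      unlike the rounding cost, carries no factor \<open>1 / l i\<close>. The constant
      \<open>2 / (sqrt 3 * pi)\<close> is about 0.368, whence 3/8.\<close>
    also have "l i * (E / pi) \<le> Q * (3/8 * E)"
    proof -
      have "l i * (E / pi) \<le> Q * (2 / sqrt 3) * (E / pi)"
        using E0 by (intro mult_right_mono prof) auto
      also have "\<dots> = Q * E * (2 / (sqrt 3 * pi))" by simp
      also have "\<dots> \<le> Q * E * (3/8)"
      proof (rule mult_left_mono)
        have "1.72 \<le> sqrt (3::real)" by (rule real_le_rsqrt) (simp add: power2_eq_square)
        then have "1.72 * 3.14 \<le> sqrt 3 * pi"
          using pi_approx by (intro mult_mono) auto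
        then show "2 / (sqrt 3 * pi) \<le> 3/8" by (simp add: field_simps)
      qed (use Q0 E0 in auto)
      finally show ?thesis by simp
    qed
    finally show ?thesis by (simp add: algebra_simps)
  qed
  \<comment> \<open>Back in the original coordinates, each is a sum of at most g terms bounded by T.
    This is the origin of the factor \<open>(real CARD('g))\<^sup>2\<close>.\<close>
  define T where "T = sqrt (Q * (CARD('g) / 4 + 3/8 * E))"
  have T0: "T \<ge> 0" using Q0 E0 by (simp add: T_def)
  have sT: "\<bar>s i\<bar> \<le> T" for i
    unfolding T_def using s_bound[of i] by (intro real_le_rsqrt) (simp only: power2_abs)
  have "\<bar>x $ \<sigma> j\<bar> \<le> CARD('g) * T" for j
  proof -
    have "\<bar>x $ \<sigma> j\<bar> \<le> \<bar>s j\<bar> + (\<Sum>k\<in>{..<j}. \<bar>\<mu> j k * s k\<bar>)"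
      unfolding s[of j] by (intro order_trans[OF abs_triangle_ineq] add_left_mono sum_abs)
    also have "\<dots> \<le> T + (\<Sum>k\<in>{..<j}. T)"
    proof (intro add_mono sT sum_mono)
      fix k assume "k \<in> {..<j}"
      then have "\<bar>\<mu> j k\<bar> \<le> 1" using \<mu>[of k j] by simp
      then have "\<bar>\<mu> j k\<bar> * \<bar>s k\<bar> \<le> 1 * T"
        using sT[of k] by (intro mult_mono) auto
      then show "\<bar>\<mu> j k * s k\<bar> \<le> T" by (simp add: abs_mult)
    qed
    also have "\<dots> = (\<Sum>k\<in>insert j {..<j}. T)" by (simp add: distrib_right)
    also have "\<dots> \<le> (\<Sum>k\<in>(UNIV::'g set). T)"
      using T0 by (intro sum_mono2) auto
    finally show ?thesis by simp
  qed
  from this[of "\<sigma> i"] have "\<bar>x $ i\<bar> \<le> CARD('g) * T" by (simp add: \<sigma>)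
  then have "\<bar>x $ i\<bar>\<^sup>2 \<le> (CARD('g) * T)\<^sup>2"
    by (intro power_mono) auto
  also have "\<dots> = (real CARD('g))\<^sup>2 * (Q * (CARD('g) / 4 + 3/8 * E))"
    using Q0 E0 by (simp add: T_def power_mult_distrib)
  finally show ?thesis by (simp add: x_def Q_def E_def mult_ac)
qed

section \<open>Theta series on a grid\<close>

text \<open>A natural number is at most its square, so on each side of w the Gaussian is dominated
  by a geometric series of ratio \<open>exp (- \<beta>)\<close>, whose sum is at most
  \<open>2 / \<beta>\<close>.\<close>

lemma sum_exp_neg_square_le:
  fixes w \<beta> :: real and F :: "int set"
  assumes "finite F" "0 < \<beta>" "\<beta> \<le> 1"
  shows "(\<Sum>m\<in>F. exp (- \<beta> * (m - w)\<^sup>2)) \<le> 4 / \<beta>"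
proof -
  define x where "x = exp (- \<beta>)"
  have x: "0 < x" "x < 1" using assms by (auto simp: x_def)
  define idx where "idx m = nat \<lfloor>\<bar>real_of_int m - w\<bar>\<rfloor>" for m :: int
  have tm: "exp (- \<beta> * (real_of_int m - w)\<^sup>2) \<le> x ^ idx m" for m
  proof -
    have "real (idx m) \<le> (real (idx m))\<^sup>2"
      by (cases "idx m") (auto simp: power2_eq_square)
    also have "\<dots> \<le> \<bar>real_of_int m - w\<bar>\<^sup>2"
      by (intro power_mono) (auto simp: idx_def)
    finally have "real (idx m) \<le> (real_of_int m - w)\<^sup>2" by simp
    then have "- \<beta> * (real_of_int m - w)\<^sup>2 \<le> real (idx m) * (- \<beta>)"
      using assms by (simp add: mult.commute)
    then show ?thesis
      unfolding x_def by (simp flip: exp_of_nat_mult)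
  qed
  have half: "(\<Sum>m\<in>G. exp (- \<beta> * (real_of_int m - w)\<^sup>2)) \<le> 2 / \<beta>" if G: "finite G" "inj_on idx G" for G
  proof -
    have "(\<Sum>m\<in>G. exp (- \<beta> * (real_of_int m - w)\<^sup>2)) \<le> (\<Sum>m\<in>G. x ^ idx m)"
      by (intro sum_mono tm)
    also have "\<dots> = (\<Sum>i\<in>idx ` G. x ^ i)"
      using G(2) by (simp add: sum.reindex)
    also have "\<dots> \<le> (\<Sum>i. x ^ i)"
      using x G(1) by (intro sum_le_suminf) (auto intro!: summable_geometric)
    also have "\<dots> = 1 / (1 - x)"
      using x by (intro suminf_geometric) auto
    also have "\<dots> \<le> 2 / \<beta>"
    proof -
      have "1 + \<beta> \<le> exp \<beta>" by (rule exp_ge_add_one_self)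
      then have "x \<le> 1 / (1 + \<beta>)"
        using assms by (simp add: x_def exp_minus field_simps)
      then have "\<beta> / (1 + \<beta>) \<le> 1 - x"
        using assms by (simp add: field_simps)
      moreover have "\<beta> / 2 \<le> \<beta> / (1 + \<beta>)"
        using assms by (intro divide_left_mono) auto
      ultimately have "\<beta> / 2 \<le> 1 - x" by linarith
      then show ?thesis using assms x by (simp add: field_simps)
    qed
    finally show ?thesis .
  qed
  have inj1: "inj_on idx {m. w \<le> real_of_int m}"
  proof (rule inj_onI)
    fix m m' assume "m \<in> {m. w \<le> real_of_int m}" "m' \<in> {m. w \<le> real_of_int m}" "idx m = idx m'"
    then have "\<lfloor>real_of_int m - w\<rfloor> = \<lfloor>real_of_int m' - w\<rfloor>"
      by (simp add: idx_def eq_nat_nat_iff)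
    then show "m = m'" by linarith
  qed
  have inj2: "inj_on idx {m. real_of_int m < w}"
  proof (rule inj_onI)
    fix m m' assume a: "m \<in> {m. real_of_int m < w}" "m' \<in> {m. real_of_int m < w}" "idx m = idx m'"
    then have "m \<le> \<lfloor>w\<rfloor>" "m' \<le> \<lfloor>w\<rfloor>" by (simp_all add: le_floor_iff)
    moreover have "nat (\<lfloor>w\<rfloor> - m) = nat (\<lfloor>w\<rfloor> - m')"
      using a by (simp add: idx_def)
    ultimately show "m = m'" by linarith
  qed
  have "(\<Sum>m\<in>F \<inter> {m. w \<le> real_of_int m}. exp (- \<beta> * (real_of_int m - w)\<^sup>2)) \<le> 2 / \<beta>"
    by (rule half) (use assms(1) in \<open>auto intro: inj_on_subset[OF inj1]\<close>)
  moreover have "(\<Sum>m\<in>F \<inter> {m. real_of_int m < w}. exp (- \<beta> * (real_of_int m - w)\<^sup>2)) \<le> 2 / \<beta>"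
    by (rule half) (use assms(1) in \<open>auto intro: inj_on_subset[OF inj2]\<close>)
  moreover have "F = (F \<inter> {m. w \<le> real_of_int m}) \<union> (F \<inter> {m. real_of_int m < w})"
    by auto
  then have "(\<Sum>m\<in>F. exp (- \<beta> * (real_of_int m - w)\<^sup>2))
     = (\<Sum>m\<in>F \<inter> {m. w \<le> real_of_int m}. exp (- \<beta> * (real_of_int m - w)\<^sup>2))
     + (\<Sum>m\<in>F \<inter> {m. real_of_int m < w}. exp (- \<beta> * (real_of_int m - w)\<^sup>2))"
    using assms(1) by (metis (no_types, lifting) sum.union_disjoint finite_Un disjoint_iff IntD2 mem_Collect_eq not_le)
  ultimately show ?thesis by simp
qed

lemma sum_exp_neg_quadratic_le:
  fixes E :: "('i::finite \<Rightarrow> int) \<Rightarrow> real" and \<xi> :: "'i \<Rightarrow> real" and F :: "('i \<Rightarrow> int) set"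
  assumes F: "finite F" and \<beta>: "0 < \<beta>" "\<beta> \<le> 1"
    and E: "\<And>k. \<beta> * (\<Sum>i\<in>UNIV. (k i - \<xi> i)\<^sup>2) \<le> E k + \<gamma>"
  shows "(\<Sum>k\<in>F. exp (- E k)) \<le> exp \<gamma> * (4 / \<beta>) ^ CARD('i)"
proof -
  define G where "G i = (\<lambda>k. k i) ` F" for i
  have "(\<Sum>k\<in>F. exp (- E k)) \<le> (\<Sum>k\<in>F. exp \<gamma> * (\<Prod>i\<in>UNIV. exp (- \<beta> * (k i - \<xi> i)\<^sup>2)))"
  proof (rule sum_mono)
    fix k
    have "exp (- E k) \<le> exp (\<gamma> + (\<Sum>i\<in>UNIV. - \<beta> * (k i - \<xi> i)\<^sup>2))"
      using E[of k] by (simp add: sum_negf sum_distrib_left)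
    then show "exp (- E k) \<le> exp \<gamma> * (\<Prod>i\<in>UNIV. exp (- \<beta> * (k i - \<xi> i)\<^sup>2))"
      by (simp add: exp_add exp_sum)
  qed
  also have "\<dots> \<le> (\<Sum>k\<in>Pi\<^sub>E UNIV G. exp \<gamma> * (\<Prod>i\<in>UNIV. exp (- \<beta> * (k i - \<xi> i)\<^sup>2)))"
    using F by (intro sum_mono2 finite_PiE) (auto simp: G_def prod_nonneg)
  also have "\<dots> = exp \<gamma> * (\<Prod>i\<in>UNIV. \<Sum>m\<in>G i. exp (- \<beta> * (m - \<xi> i)\<^sup>2))"
    using F by (subst prod_sum_PiE) (auto simp: G_def sum_distrib_left)
  also have "\<dots> \<le> exp \<gamma> * (\<Prod>i\<in>(UNIV :: 'i set). 4 / \<beta>)"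
    using F \<beta> by (intro mult_left_mono prod_mono conjI sum_nonneg sum_exp_neg_square_le) (auto simp: G_def)
  finally show ?thesis by simp
qed

lemma cis_sum: "finite I \<Longrightarrow> cis (\<Sum>i\<in>I. f i) = (\<Prod>i\<in>I. cis (f i))"
  by (induction I rule: finite_induct) (auto simp flip: cis_mult)

text \<open>The series is truncated to the box around \<open>\<xi>\<close> that contains all terms with \<open>E k \<le> r\<close>.\<close>
lemma card_small_theta_sum:
  fixes C :: "('i::finite \<Rightarrow> int) \<Rightarrow> complex" and E :: "('i \<Rightarrow> int) \<Rightarrow> real" and \<xi> :: "'i \<Rightarrow> real"
    and A s r \<rho> \<Theta> \<delta> :: real and D q d :: nat
  assumes C: "\<And>k. norm (C k) = A * exp (- s * E k)" and A: "0 < A" and s: "1 \<le> s"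
    and E0: "\<And>k. 0 \<le> E k" and near: "\<exists>k. s * E k \<le> ln 2"
    and r: "1 \<le> r" and box: "\<And>k i. E k \<le> r \<Longrightarrow> \<bar>k i - \<xi> i\<bar> \<le> \<rho>" and d: "d = nat \<lfloor>2 * \<rho>\<rfloor>"
    and \<Theta>: "\<And>F. finite F \<Longrightarrow> (\<Sum>k\<in>F. exp (- (E k / 2))) \<le> \<Theta>"
    and tail: "\<Theta> * exp (- s * r / 2) \<le> (\<delta> / 4) ^ (CARD('i) * d) / 4"
    and D: "D > 0" and q: "q dvd D" and \<delta>: "0 < \<delta>" "\<delta> < 1"
  shows "real (card {f \<in> UNIV \<rightarrow>\<^sub>E {..<D}.
      norm (\<Sum>\<^sub>\<infinity>k. C k * cis (2 * pi * (q * (\<Sum>i\<in>UNIV. k i * real (f i)) / D)))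
        < A * ((\<delta> / 4) ^ (CARD('i) * d) / 4)})
     \<le> CARD('i) * d * (\<delta> + q / D) * D ^ CARD('i)"
proof -
  define g where "g = CARD('i)"
  define \<epsilon> where "\<epsilon> = (\<delta> / 4) ^ d"
  have \<epsilon>0: "0 < \<epsilon>" using \<delta> by (simp add: \<epsilon>_def)
  have \<epsilon>g: "\<epsilon> ^ g = (\<delta> / 4) ^ (g * d)" by (simp add: \<epsilon>_def mult.commute flip: power_mult)
  define lo where "lo i = \<lceil>\<xi> i - \<rho>\<rceil>" for i
  define shift where "shift n = (\<lambda>i. lo i + int (n i))" for n :: "'i \<Rightarrow> nat"
  define N where "N = (UNIV \<rightarrow>\<^sub>E {..d} :: ('i \<Rightarrow> nat) set)"
  define Box where "Box = shift ` N"
  have finN: "finite N" unfolding N_def by (intro finite_PiE) auto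
  have inj: "inj_on shift N"
    by (rule inj_onI) (auto simp: shift_def fun_eq_iff)
  have in_box: "k \<in> Box" if "E k \<le> r" for k
  proof -
    have *: "lo i \<le> k i" "nat (k i - lo i) \<le> d" for i
    proof -
      have b: "\<bar>k i - \<xi> i\<bar> \<le> \<rho>" by (rule box[OF that])
      then show "lo i \<le> k i" unfolding lo_def by linarith
      have "\<xi> i - \<rho> \<le> of_int (lo i)" unfolding lo_def by linarith
      with b have "of_int (k i - lo i) \<le> 2 * \<rho>" by simp
      then have "k i - lo i \<le> \<lfloor>2 * \<rho>\<rfloor>" by (simp only: le_floor_iff)
      then show "nat (k i - lo i) \<le> d" unfolding d by (rule nat_mono)
    qed
    have "(\<lambda>i. nat (k i - lo i)) \<in> N" using * by (auto simp: N_def)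
    moreover have "k = shift (\<lambda>i. nat (k i - lo i))"
      using * by (auto simp: shift_def)
    ultimately show ?thesis unfolding Box_def by blast
  qed
  define B where "B = A * \<Theta> * exp (- s * r / 2)"
  \<comment> \<open>Half of the exponent exceeds \<open>s * r / 2\<close> and makes the tail small;
    the other half is at least \<open>E k / 2\<close> and is kept for summation, so that \<Theta>
    does not depend on s.\<close>
  have outside: "exp (- s * E k) \<le> exp (- s * r / 2) * exp (- (E k / 2))" if "k \<notin> Box" for k
  proof -
    have "r < E k" using that in_box[of k] by force
    then have "s * r \<le> s * E k" using s by (intro mult_left_mono) auto
    moreover have "1 * E k \<le> s * E k" using s E0[of k] by (intro mult_right_mono) auto
    ultimately have "- s * E k \<le> - s * r / 2 + - (E k / 2)" by simp
    then show ?thesis by (simp flip: exp_add)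
  qed
  have tail_sum: "(\<Sum>k\<in>F. norm (C k)) \<le> B" if F: "finite F" "F \<subseteq> - Box" for F
  proof -
    have "(\<Sum>k\<in>F. norm (C k)) \<le> (\<Sum>k\<in>F. A * (exp (- s * r / 2) * exp (- (E k / 2))))"
      unfolding C using F A by (intro sum_mono mult_left_mono outside) auto
    also have "\<dots> = A * exp (- s * r / 2) * (\<Sum>k\<in>F. exp (- (E k / 2)))"
      by (simp add: sum_distrib_left mult_ac)
    also have "\<dots> \<le> A * exp (- s * r / 2) * \<Theta>"
      using A by (intro mult_left_mono \<Theta> F) auto
    finally show ?thesis by (simp add: B_def mult_ac)
  qed
  have B: "B \<le> A * (\<epsilon> ^ g / 4)"
    unfolding B_def mult.assoc \<epsilon>g using tail A by (intro mult_left_mono) (auto simp: g_def)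
  \<comment> \<open>The near-minimiser lies in the box since \<open>ln 2 < 1 \<le> r\<close>, and
    its coefficient is at least A / 2. As the tail is at most
    \<open>A * (\<epsilon> ^ g / 4)\<close>, a quarter of \<open>A * \<epsilon> ^ g\<close>
    survives.\<close>
  obtain k0 where k0: "s * E k0 \<le> ln 2" using near by blast
  have "E k0 \<le> r"
  proof -
    have "1 * E k0 \<le> s * E k0" using s E0[of k0] by (intro mult_right_mono) auto
    then show ?thesis using k0 ln_2_less_1 r by linarith
  qed
  then obtain n0 where n0: "n0 \<in> N" "k0 = shift n0" using in_box unfolding Box_def by blast
  have Ck0: "A / 2 \<le> norm (C (shift n0))"
  proof -
    have "exp (- ln 2) \<le> exp (- s * E k0)" using k0 by simp
    then have "A * (1 / 2) \<le> A * exp (- s * E k0)"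
      using A by (intro mult_left_mono) (auto simp: exp_minus)
    then show ?thesis unfolding C n0(2)[symmetric] by simp
  qed
  define w where "w m = cis (2 * pi * (q * real m / D))" for m :: nat
  define T where "T f = (\<Sum>\<^sub>\<infinity>k. C k * cis (2 * pi * (q * (\<Sum>i\<in>UNIV. k i * real (f i)) / D)))" for f :: "'i \<Rightarrow> nat"
  define P where "P f = (\<Sum>n\<in>N. C (shift n) * (\<Prod>i\<in>UNIV. w (f i) ^ n i))" for f
  have T_ge: "norm (P f) - B \<le> norm (T f)" for f
  proof -
    define t where "t k = C k * cis (2 * pi * (q * (\<Sum>i\<in>UNIV. k i * real (f i)) / D))" for k
    have nt: "norm (t k) = norm (C k)" for k by (simp add: t_def norm_mult)
    have abs: "(\<lambda>k. norm (t k)) summable_on - Box"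
      unfolding nt using tail_sum by (intro nonneg_bdd_above_summable_on) (auto simp: bdd_above_def)
    then have sm: "t summable_on - Box" by (rule abs_summable_summable)
    have finB: "finite Box" using finN by (simp add: Box_def)
    have "T f = infsum t (Box \<union> - Box)" by (simp add: T_def t_def[abs_def])
    also have "\<dots> = infsum t Box + infsum t (- Box)"
      using finB sm by (intro infsum_Un_disjoint) auto
    also have "infsum t Box = sum t Box" using finB by simp
    finally have 1: "T f = sum t Box + infsum t (- Box)" .
    have "norm (infsum t (- Box)) \<le> infsum (\<lambda>k. norm (t k)) (- Box)"
      using abs by (rule norm_infsum_bound)
    also have "\<dots> \<le> B"
      using abs unfolding nt by (intro infsum_le_finite_sums tail_sum)
    finally have 2: "norm (infsum t (- Box)) \<le> B" .
    have "sum t Box = (\<Sum>n\<in>N. t (shift n))"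
      unfolding Box_def using inj by (simp add: sum.reindex)
    \<comment> \<open>The phase of the corner \<open>lo\<close> is common to all terms. Taking it
      out moves the exponents to {0..d}, which turns the sum into a polynomial.\<close>
    also have "\<dots> = (\<Sum>n\<in>N. cis (2 * pi * (q * (\<Sum>i\<in>UNIV. lo i * real (f i)) / D)) *
        (C (shift n) * (\<Prod>i\<in>UNIV. w (f i) ^ n i)))"
    proof (rule sum.cong)
      fix n
      have "(\<Prod>i\<in>UNIV. w (f i) ^ n i) = cis (\<Sum>i\<in>UNIV. real (n i) * (2 * pi * (q * real (f i) / D)))"
        by (simp add: w_def Complex.DeMoivre cis_sum)
      also have "(\<Sum>i\<in>UNIV. real (n i) * (2 * pi * (q * real (f i) / D)))
         = 2 * pi * (q * (\<Sum>i\<in>UNIV. real (n i) * real (f i)) / D)"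
        by (simp add: sum_distrib_left sum_divide_distrib mult_ac)
      finally have "cis (2 * pi * (q * (\<Sum>i\<in>UNIV. lo i * real (f i)) / D)) * (\<Prod>i\<in>UNIV. w (f i) ^ n i)
         = cis (2 * pi * (q * (\<Sum>i\<in>UNIV. shift n i * real (f i)) / D))"
        by (simp add: cis_mult shift_def distrib_right sum.distrib distrib_left add_divide_distrib)
      then show "t (shift n) = cis (2 * pi * (q * (\<Sum>i\<in>UNIV. lo i * real (f i)) / D)) *
        (C (shift n) * (\<Prod>i\<in>UNIV. w (f i) ^ n i))"
        by (simp add: t_def mult_ac)
    qed simp
    also have "\<dots> = cis (2 * pi * (q * (\<Sum>i\<in>UNIV. lo i * real (f i)) / D)) * P f"
      by (simp add: P_def sum_distrib_left)
    finally have "norm (sum t Box) = norm (P f)" by (simp add: norm_mult)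
    then show ?thesis
      unfolding 1 using 2 norm_diff_ineq[of "sum t Box" "infsum t (- Box)"] by linarith
  qed
  define Bad where "Bad = {f \<in> UNIV \<rightarrow>\<^sub>E {..<D}. norm (P f) < norm (C (shift n0)) * \<epsilon> ^ g}"
  have "finite (UNIV \<rightarrow>\<^sub>E {..<D} :: ('i \<Rightarrow> nat) set)" by (intro finite_PiE) auto
  then have "finite Bad" by (simp add: Bad_def)
  moreover have "{f \<in> UNIV \<rightarrow>\<^sub>E {..<D}. norm (T f) < A * (\<epsilon> ^ g / 4)} \<subseteq> Bad"
  proof clarify
    fix f :: "'i \<Rightarrow> nat" assume f: "f \<in> UNIV \<rightarrow>\<^sub>E {..<D}" "norm (T f) < A * (\<epsilon> ^ g / 4)"
    have "norm (P f) < A / 2 * \<epsilon> ^ g"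
      using f(2) T_ge[of f] B by simp
    also have "\<dots> \<le> norm (C (shift n0)) * \<epsilon> ^ g"
      using Ck0 \<epsilon>0 by (intro mult_right_mono) auto
    finally show "f \<in> Bad" using f(1) by (simp add: Bad_def)
  qed
  ultimately have "real (card {f \<in> UNIV \<rightarrow>\<^sub>E {..<D}. norm (T f) < A * (\<epsilon> ^ g / 4)}) \<le> real (card Bad)"
    by (simp add: card_mono)
  also have "real (card Bad) * D \<le> g * (d * (\<delta> * D + q)) * D ^ g"
    unfolding Bad_def P_def N_def g_def
  proof (rule card_small_values_multivariate)
    show "real (card {m. m < D \<and> norm (\<Sum>k\<le>d. c k * w m ^ k) < norm (c k0) * \<epsilon>}) \<le> d * (\<delta> * D + q)"
      if "k0 \<le> d" for c :: "nat \<Rightarrow> complex" and k0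
      using card_small_values_univariate[OF D q \<delta> that, of c] by (simp add: w_def \<epsilon>_def)
    show "n0 \<in> UNIV \<rightarrow>\<^sub>E {..d}" using n0 by (simp add: N_def)
  qed (use \<epsilon>0 in auto)
  then have "real (card Bad) \<le> g * d * (\<delta> + q / D) * D ^ g"
    using D by (simp add: field_simps)
  finally show ?thesis
    unfolding T_def \<epsilon>g unfolding g_def .
qed

section \<open>Theta functions as exponential series in the grid variable\<close>

lemma cdot_cvec_of_real:
  "cdot (cvec x) (cvec y) = of_real (x \<bullet> y)"
  by (simp add: cdot_def cvec_def inner_vec_def)

lemma cdot_add_right: "cdot x (y + z) = cdot x y + cdot x z"
  by (simp add: cdot_def distrib_left sum.distrib)

lemma cdot_scaleR_right: "cdot x (c *\<^sub>R y) = c *\<^sub>R cdot x y"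
  by (simp add: cdot_def scaleR_sum_right)

lemma Im_cdot_cvec: "Im (cdot (cvec x) y) = x \<bullet> Im_vec y"
  by (simp add: cdot_def cvec_def inner_vec_def Im_vec_def)

lemma Im_vec_matrix_cvec: "Im_vec (\<tau> *v cvec x) = Im_mat \<tau> *v x"
  by (simp add: vec_eq_iff Im_vec_def Im_mat_def matrix_vector_mult_def cvec_def)

lemma scaleR_matrix_vector: "(c *\<^sub>R (A :: complex ^ 'n ^ 'm)) *v x = c *\<^sub>R (A *v x)"
  by (simp add: vec_eq_iff matrix_vector_mult_def scaleR_sum_right)

lemma norm_e_pi: "norm (e_pi x) = exp (- pi * Im x)"
  by (simp add: e_pi_def)

lemma e_pi_add: "e_pi (x + y) = e_pi x * e_pi y"
  by (simp add: e_pi_def distrib_left exp_add)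

lemma e_pi_of_real: "e_pi (of_real x) = cis (pi * x)"
  by (simp add: e_pi_def cis_conv_exp mult_ac)

text \<open>Completing the square: \<open>Im_mat \<tau> *v v = - y\<close>, so translation by v
  produces exactly the linear term of the theta series.\<close>

lemma norm_tau_expand:
  assumes "\<tau> \<in> siegel" and v: "v = - (matrix_inv (Im_mat \<tau>) *v y)"
  shows "(norm_tau \<tau> (n - v))\<^sup>2 =
    pi * (n \<bullet> (Im_mat \<tau> *v n) + 2 * (n \<bullet> y) + y \<bullet> (matrix_inv (Im_mat \<tau>) *v y))"
proof -
  let ?Y = "Im_mat \<tau>"
  have "?Y *v (matrix_inv ?Y *v y) = y"
    using matrix_inv_inverse[OF siegel_invertible[OF assms(1)]] by (simp add: matrix_vector_mul_assoc)
  then have Yv: "?Y *v v = - y"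
    by (simp add: v matrix_vector_mult_diff_distrib[of _ 0, simplified])
  have "transpose ?Y = ?Y"
    using assms(1) by (simp add: siegel_def vec_eq_iff transpose_def Im_mat_def)
  then have "v \<bullet> (?Y *v n) = n \<bullet> (?Y *v v)"
    by (metis dot_lmul_matrix inner_commute transpose_matrix_vector)
  then show ?thesis
    unfolding norm_tau_nonneg(3)[OF assms(1)]
    by (simp add: matrix_vector_mult_diff_distrib inner_diff_left inner_diff_right Yv)
      (simp add: v inner_commute inner_add_right)
qed

definition shift_vec :: "real ^ 'g \<Rightarrow> ('g \<Rightarrow> int) \<Rightarrow> real ^ 'g" where
  "shift_vec a k = (\<chi> i. real_of_int (k i) + a $ i / 2)"

lemma bij_shift_vec: "bij_betw (shift_vec a) UNIV (half_shift a)"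
proof (rule bij_betw_imageI)
  show "inj (shift_vec a)"
    by (rule injI) (auto simp: shift_vec_def vec_eq_iff)
  show "range (shift_vec a) = half_shift a"
  proof (intro equalityI subsetI)
    fix x assume "x \<in> range (shift_vec a)"
    then obtain k where "x = shift_vec a k" by blast
    then have "x = (\<chi> i. real_of_int (k i)) + (1/2) *\<^sub>R a"
      by (simp add: shift_vec_def vec_eq_iff)
    then show "x \<in> half_shift a"
      unfolding half_shift_def by (rule image_eqI) (simp add: int_vecs_def)
  next
    fix x assume "x \<in> half_shift a"
    then obtain n where n: "n \<in> int_vecs" "x = n + (1/2) *\<^sub>R a" by (auto simp: half_shift_def)
    then have "x = shift_vec a (\<lambda>i. \<lfloor>n $ i\<rfloor>)"
      by (simp add: shift_vec_def vec_eq_iff int_vecs_def)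
    then show "x \<in> range (shift_vec a)" by blast
  qed
qed

text \<open>A real translation u changes phases only, so C can be chosen before u. The part a / 2 of
  the summation index contributes a phase common to all terms, which leaves integral frequencies; b
  is absorbed in the phases of C, and the Gaussian prefactor completes the square.\<close>

lemma norm_theta_tilde_series:
  fixes z :: "complex ^ 'g" and \<tau> :: "complex ^ 'g ^ 'g" and s :: real
  assumes \<tau>: "\<tau> \<in> siegel" and s: "0 < s"
    and v: "v = - (matrix_inv (Im_mat \<tau>) *v Im_vec z)"
  obtains C :: "('g \<Rightarrow> int) \<Rightarrow> complex"
  where "\<And>k. norm (C k) = exp (- s * (norm_tau \<tau> (shift_vec a k - v))\<^sup>2)"
    "\<And>u. norm (theta_tilde a b (s *\<^sub>R (z + cvec u)) (s *\<^sub>R \<tau>)) =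
       norm (\<Sum>\<^sub>\<infinity>k. C k * cis (2 * pi * (s * (\<Sum>i\<in>UNIV. k i * u $ i))))"
proof -
  define Y where "Y = Im_mat \<tau>"
  define y where "y = Im_vec z"
  define e0 where "e0 = exp (- pi * (s * (y \<bullet> (matrix_inv Y *v y))))"
  define c where "c n = e_pi (s *\<^sub>R cdot (cvec n) (\<tau> *v cvec n) + 2 * cdot (cvec n) (s *\<^sub>R z + cvec ((1/2) *\<^sub>R b)))"
    for n
  define C where "C k = of_real e0 * c (shift_vec a k)" for k
  have Y_inv: "invertible Y" unfolding Y_def by (rule siegel_invertible[OF \<tau>])
  \<comment> \<open>Scaling z and \<tau> together cancels in the centre, so v is the same at all
    levels.\<close>
  have scaled: "matrix_inv (s *\<^sub>R Y) *v (s *\<^sub>R y) = matrix_inv Y *v y"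
  proof -
    have "x \<bullet> ((s *\<^sub>R Y) *v x) > 0" if "x \<noteq> 0" for x
      using \<tau> s that by (auto simp: siegel_def Y_def scaleR_matrix_vector_assoc[symmetric])
    then have inv: "invertible (s *\<^sub>R Y)" by (rule invertible_pos_def)
    have "s *\<^sub>R y = (s *\<^sub>R Y) *v (matrix_inv Y *v y)"
      unfolding scaleR_matrix_vector_assoc[symmetric]
      using matrix_inv_inverse(1)[OF Y_inv] by (simp add: matrix_vector_mul_assoc)
    then show ?thesis
      using matrix_inv_inverse(2)[OF inv] by (simp add: matrix_vector_mul_assoc matrix_mul_assoc)
  qed
  show ?thesis
  proof
    fix k
    let ?n = "shift_vec a k"
    have "norm (C k) = exp (- pi * (s * (y \<bullet> (matrix_inv Y *v y)))
        + - pi * (s * (?n \<bullet> (Y *v ?n)) + 2 * (s * (?n \<bullet> y))))"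
      by (simp add: C_def norm_mult c_def norm_e_pi Im_cdot_cvec Im_vec_matrix_cvec e0_def Y_def
          cdot_add_right cdot_scaleR_right cdot_cvec_of_real y_def flip: exp_add)
    also have "\<dots> = exp (- s * (norm_tau \<tau> (?n - v))\<^sup>2)"
      unfolding norm_tau_expand[OF \<tau> v] by (simp add: Y_def y_def algebra_simps)
    finally show "norm (C k) = exp (- s * (norm_tau \<tau> (?n - v))\<^sup>2)" .
  next
    fix u :: "real ^ 'g"
    have Im: "Im_vec (s *\<^sub>R (z + cvec u)) = s *\<^sub>R y" "Im_mat (s *\<^sub>R \<tau>) = s *\<^sub>R Y"
      by (simp_all add: vec_eq_iff Im_vec_def Im_mat_def cvec_def y_def Y_def)
    have e0: "exp (- pi * (Im_vec (s *\<^sub>R (z + cvec u)) \<bullet> (matrix_inv (Im_mat (s *\<^sub>R \<tau>)) *v Im_vec (s *\<^sub>R (z + cvec u))))) = e0"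
      unfolding Im scaled e0_def by simp
    have trm: "of_real e0 * e_pi (cdot (cvec (shift_vec a k)) ((s *\<^sub>R \<tau>) *v cvec (shift_vec a k))
          + 2 * cdot (cvec (shift_vec a k)) (s *\<^sub>R (z + cvec u) + cvec ((1/2) *\<^sub>R b)))
        = cis (pi * (s * (a \<bullet> u))) * (C k * cis (2 * pi * (s * (\<Sum>i\<in>UNIV. k i * u $ i))))" for k
    proof -
      let ?n = "shift_vec a k"
      have "cdot (cvec ?n) ((s *\<^sub>R \<tau>) *v cvec ?n) + 2 * cdot (cvec ?n) (s *\<^sub>R (z + cvec u) + cvec ((1/2) *\<^sub>R b))
        = (s *\<^sub>R cdot (cvec ?n) (\<tau> *v cvec ?n) + 2 * cdot (cvec ?n) (s *\<^sub>R z + cvec ((1/2) *\<^sub>R b)))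
          + of_real (2 * (s * (?n \<bullet> u)))"
        by (simp add: cdot_add_right cdot_scaleR_right scaleR_matrix_vector cdot_cvec_of_real algebra_simps)
          (simp add: scaleR_conv_of_real)
      moreover have "2 * (s * (?n \<bullet> u)) = s * (a \<bullet> u) + 2 * (s * (\<Sum>i\<in>UNIV. k i * u $ i))"
        by (simp add: shift_vec_def inner_vec_def distrib_right sum.distrib sum_distrib_left algebra_simps)
      ultimately show ?thesis
        by (simp only: e_pi_add e_pi_of_real of_real_add C_def c_def distrib_left cis_mult[symmetric])
          (simp add: e_pi_of_real e_pi_add[symmetric] mult_ac cis_mult distrib_left)
    qed
    have "theta_tilde a b (s *\<^sub>R (z + cvec u)) (s *\<^sub>R \<tau>) = of_real e0 *
       (\<Sum>\<^sub>\<infinity>k. e_pi (cdot (cvec (shift_vec a k)) ((s *\<^sub>R \<tau>) *v cvec (shift_vec a k))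
          + 2 * cdot (cvec (shift_vec a k)) (s *\<^sub>R (z + cvec u) + cvec ((1/2) *\<^sub>R b))))"
      unfolding theta_tilde_def theta_def e0
      by (subst infsum_reindex_bij_betw[OF bij_shift_vec[of a], symmetric]) simp
    also have "\<dots> = cis (pi * (s * (a \<bullet> u))) * (\<Sum>\<^sub>\<infinity>k. C k * cis (2 * pi * (s * (\<Sum>i\<in>UNIV. k i * u $ i))))"
      unfolding infsum_cmult_right'[symmetric] trm ..
    finally show "norm (theta_tilde a b (s *\<^sub>R (z + cvec u)) (s *\<^sub>R \<tau>)) =
       norm (\<Sum>\<^sub>\<infinity>k. C k * cis (2 * pi * (s * (\<Sum>i\<in>UNIV. k i * u $ i))))"
      by (simp add: norm_mult)
  qed
qed

definition grid_point :: "nat \<Rightarrow> ('g \<Rightarrow> nat) \<Rightarrow> real ^ 'g" where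
  "grid_point D f = (\<chi> i. real (f i) / real D)"

lemma bij_grid_point:
  assumes "D > 0"
  shows "bij_betw (grid_point D) (UNIV \<rightarrow>\<^sub>E {..<D}) (grid D :: (real ^ 'g) set)"
proof (rule bij_betw_imageI)
  show "inj_on (grid_point D) (UNIV \<rightarrow>\<^sub>E {..<D} :: ('g \<Rightarrow> nat) set)"
    using assms by (intro inj_onI) (auto simp: grid_point_def vec_eq_iff)
  show "grid_point D ` (UNIV \<rightarrow>\<^sub>E {..<D}) = (grid D :: (real ^ 'g) set)"
  proof (intro equalityI subsetI)
    fix t :: "real ^ 'g" assume "t \<in> grid D"
    then obtain f where "\<And>i. f i < D \<and> t $ i = real (f i) / real D"
      unfolding grid_def by simp metis
    then show "t \<in> grid_point D ` (UNIV \<rightarrow>\<^sub>E {..<D})"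
      by (intro image_eqI[of _ _ f]) (auto simp: grid_point_def vec_eq_iff)
  next
    fix t :: "real ^ 'g" assume "t \<in> grid_point D ` (UNIV \<rightarrow>\<^sub>E {..<D})"
    then obtain f where f: "f \<in> UNIV \<rightarrow>\<^sub>E {..<D}" "t = grid_point D f" by blast
    have "f i < D" for i using PiE_mem[OF f(1), of i] by simp
    then show "t \<in> grid D" by (auto simp: grid_def grid_point_def f(2))
  qed
qed

lemma card_grid: "D > 0 \<Longrightarrow> card (grid D :: (real ^ 'g) set) = D ^ CARD('g)"
  using bij_betw_same_card[OF bij_grid_point[where ?'g = 'g], of D] by (simp add: card_PiE)

lemma finite_grid: "D > 0 \<Longrightarrow> finite (grid D :: (real ^ 'g) set)"
  using bij_betw_finite[OF bij_grid_point[where ?'g = 'g], of D] by (simp add: finite_PiE)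

section \<open>Parameters and counting\<close>

lemma card_Collect_bij_betw:
  assumes "bij_betw h A B" "\<And>x. P (h x) \<longleftrightarrow> R x"
  shows "card {y \<in> B. P y} = card {x \<in> A. R x}"
proof -
  have "{y \<in> B. P y} = h ` {x \<in> A. R x}"
    using assms bij_betw_imp_surj_on by fast
  moreover have "inj_on h {x \<in> A. R x}"
    using assms(1) by (rule inj_on_subset[OF bij_betw_imp_inj_on]) auto
  ultimately show ?thesis by (simp add: card_image)
qed

lemma hkz_factor_ge_1: "g \<ge> 1 \<Longrightarrow> 1 \<le> hkz_factor g"
  unfolding hkz_factor_def by simp

section \<open>Choice of the constants\<close>

definition log_exponent :: "nat \<Rightarrow> real" where
  "log_exponent g = 1 + (ln (real g))\<^sup>2"

text \<open>Makes the arc weight at level 0 equal to 2 / (2^(20 L) * 4^g) with L =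
  \<open>log_exponent g\<close>: the power of L offsets \<open>g * box_degree g\<close>, and 4^g
  offsets the number of pairs (a, b).\<close>

definition weight_exponent :: "nat \<Rightarrow> real" where
  "weight_exponent g = 1 + 20 * log_exponent g + 2 * real g"

text \<open>The proportion of grid points sacrificed near each root at level \<open>j\<close>. The factor \<open>2 powr - j\<close>
  makes the total over all levels bounded; it costs only \<open>j\<close> in the logarithm of the lower bound,
  which the Gaussian decay at scale \<open>2 ^ j\<close> absorbs.\<close>
definition arc_weight :: "nat \<Rightarrow> nat \<Rightarrow> real" where
  "arc_weight g j = 2 powr (2 - real j - weight_exponent g)"

text \<open>The square root of \<open>g^2 * Q * r\<close>, the coordinate bound at excess
  \<open>r = 16 * g^4 * Q * W^2\<close>, where Q is the profile factor and W the weight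
  exponent.\<close>

definition box_radius :: "nat \<Rightarrow> real" where
  "box_radius g = 4 * real g ^ 3 * hkz_factor g * weight_exponent g"

definition box_degree :: "nat \<Rightarrow> nat" where
  "box_degree g = nat \<lfloor>2 * box_radius g\<rfloor>"

lemma weight_exponent_ge:
  assumes "g \<ge> 1"
  shows "23 \<le> weight_exponent g"
proof -
  have "1 \<le> real g" using assms by simp
  moreover define u where "u = (ln (real g))\<^sup>2"
  moreover have "0 \<le> u" by (simp add: u_def)
  ultimately show ?thesis
    unfolding weight_exponent_def log_exponent_def u_def[symmetric] by simp
qed

lemma arc_weight_bounds: "g \<ge> 1 \<Longrightarrow> 0 < arc_weight g j" "g \<ge> 1 \<Longrightarrow> arc_weight g j < 1"
proof -
  assume "g \<ge> 1"
  from weight_exponent_ge[OF this] have "2 - real j - weight_exponent g < 0" by simp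
  then show "arc_weight g j < 1"
    unfolding arc_weight_def by (simp add: powr_less_one)
qed (simp add: arc_weight_def)

lemma arc_weight_power:
  "(arc_weight g j / 4) ^ n = exp (- (n * (ln 2 * (real j + weight_exponent g))))"
proof -
  have "arc_weight g j / 4 = 2 powr (2 - real j - weight_exponent g) / 2 powr 2"
    by (simp add: arc_weight_def)
  also have "\<dots> = 2 powr (2 - real j - weight_exponent g - 2)"
    by (rule powr_diff[symmetric])
  also have "\<dots> = 2 powr (- (real j + weight_exponent g))"
    by (rule arg_cong) simp
  also have "\<dots> = exp (- (ln 2 * (real j + weight_exponent g)))"
    by (simp add: powr_def algebra_simps)
  finally show ?thesis
    by (simp flip: exp_of_nat_mult)
qed

lemma box_degree_le:
  assumes "g \<ge> 1"
  shows "real (g * box_degree g) \<le> 8 * (real g ^ 4 * hkz_factor g) * weight_exponent g"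
proof -
  have "0 \<le> box_radius g"
    using hkz_factor_ge_1[OF assms] weight_exponent_ge[OF assms] by (simp add: box_radius_def)
  then have "real (box_degree g) \<le> 2 * box_radius g"
    by (simp add: box_degree_def)
  then have "real g * real (box_degree g) \<le> real g * (2 * box_radius g)"
    by (intro mult_left_mono) auto
  also have "\<dots> = 8 * (real g ^ 4 * hkz_factor g) * weight_exponent g"
    by (simp add: box_radius_def power4_eq_xxxx power3_eq_cube)
  finally show ?thesis by simp
qed

text \<open>The logarithm of the left side grows at most quadratically in \<open>ln g\<close>,
  because of the profile factor; this dictates the shape of \<open>log_exponent\<close>. The divisor
  24 meets a 12 in the final count and leaves one half.\<close>

lemma box_degree_le_powr:
  assumes g: "g \<ge> 1"
  shows "real (g * box_degree g) \<le> 2 powr (20 * log_exponent g) / 24"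
proof -
  define x where "x = ln (real g)"
  have x: "0 \<le> x" "real g = exp x" using g by (simp_all add: x_def)
  have ln2: "2/3 \<le> ln (2::real)" "ln (2::real) \<le> 25/36"
    by (rule ln2_ge_two_thirds, rule ln2_le_25_over_36)
  define K where "K = exp x * exp (x\<^sup>2)"
  have W: "weight_exponent g \<le> 23 * K"
  proof -
    have e: "1 + x\<^sup>2 \<le> exp (x\<^sup>2)" by (rule exp_ge_add_one_self)
    also have "1 * exp (x\<^sup>2) \<le> exp x * exp (x\<^sup>2)" using x by (intro mult_right_mono) auto
    finally have 1: "1 + x\<^sup>2 \<le> K" by (simp add: K_def)
    have "exp x * 1 \<le> exp x * exp (x\<^sup>2)" by (intro mult_left_mono) auto
    then have 2: "exp x \<le> K" by (simp add: K_def)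
    have "weight_exponent g = 1 + 20 * (1 + x\<^sup>2) + 2 * exp x"
      by (simp add: weight_exponent_def log_exponent_def x_def[symmetric] x(2)[symmetric])
    also have "\<dots> \<le> (1 + x\<^sup>2) + 20 * (1 + x\<^sup>2) + 2 * exp x" by simp
    also have "\<dots> \<le> 23 * K" using 1 2 by simp
    finally show ?thesis .
  qed
  have ln4: "ln (4::real) = 2 * ln 2" using ln_realpow[of 2 2] by simp
  have "hkz_factor g = exp ((2 * ln 2 + x) * (2 + x))"
    using g by (simp add: hkz_factor_def ln_mult ln4 x_def)
  then have "24 * (8 * (real g ^ 4 * hkz_factor g) * weight_exponent g)
     \<le> 192 * (exp x ^ 4 * exp ((2 * ln 2 + x) * (2 + x))) * (23 * K)"
    using W by (simp add: x(2))
  also have "\<dots> = 4416 * exp (4 * x + x + (2 * ln 2 + x) * (2 + x) + x\<^sup>2)"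
  proof -
    have "exp x ^ 4 = exp (4 * x)" using exp_of_nat_mult[of 4 x] by simp
    then have "192 * (exp x ^ 4 * exp ((2 * ln 2 + x) * (2 + x))) * (23 * K)
        = 4416 * (exp (4 * x) * exp x * exp ((2 * ln 2 + x) * (2 + x)) * exp (x\<^sup>2))"
      by (simp add: K_def)
    then show ?thesis by (simp only: exp_add)
  qed
  \<comment> \<open>The constant 4416 = 24 * 8 * 23 is rounded up to \<open>2 ^ 13\<close>.\<close>
  also have "\<dots> \<le> exp (13 * ln 2) * exp (4 * x + x + (2 * ln 2 + x) * (2 + x) + x\<^sup>2)"
  proof (rule mult_right_mono)
    have "exp (13 * ln 2) = (2::real) ^ 13"
      using exp_of_nat_mult[of 13 "ln 2 :: real"] by simp
    then show "4416 \<le> exp (13 * ln (2::real))" by simp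
  qed simp
  also have "\<dots> = exp (13 * ln 2 + (4 * x + x + (2 * ln 2 + x) * (2 + x) + x\<^sup>2))"
    by (simp add: exp_add)
  also have "\<dots> \<le> exp (20 * (1 + x\<^sup>2) * ln 2)"
  proof -
    have "ln 2 * (2 * x) \<le> 25/36 * (2 * x)" using ln2 x by (intro mult_right_mono) auto
    moreover have "2/3 * (20 * x\<^sup>2) \<le> ln 2 * (20 * x\<^sup>2)" using ln2 by (intro mult_right_mono) auto
    \<comment> \<open>The linear terms add up to at most \<open>(7 + 25/18) * x\<close>, just below
      \<open>42/5 * x\<close>. The square trades them for a quadratic term and the constant 2, which
      is covered by the spare \<open>3 * ln 2\<close>.\<close>
    moreover have "0 \<le> 2 * (1 - 21/10 * x)\<^sup>2" by simp
    then have "42/5 * x \<le> 2 + 441/50 * x\<^sup>2" by (simp add: power2_eq_square algebra_simps)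
    moreover have "13 * ln 2 + (4 * x + x + (2 * ln 2 + x) * (2 + x) + x\<^sup>2)
        = 17 * ln 2 + 7 * x + ln 2 * (2 * x) + 2 * x\<^sup>2"
      by (simp add: power2_eq_square algebra_simps)
    moreover have "20 * (1 + x\<^sup>2) * ln 2 = 20 * ln 2 + ln 2 * (20 * x\<^sup>2)"
      by (simp add: algebra_simps)
    ultimately have "13 * ln 2 + (4 * x + x + (2 * ln 2 + x) * (2 + x) + x\<^sup>2) \<le> 20 * (1 + x\<^sup>2) * ln 2"
      using ln2 zero_le_power2[of x] x(1) by linarith
    then show ?thesis by simp
  qed
  also have "\<dots> = 2 powr (20 * log_exponent g)"
    by (simp add: powr_def log_exponent_def x_def)
  finally show ?thesis using box_degree_le[OF g] by simp
qed

text \<open>The negative logarithm of the power on the right is at most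
  \<open>50/9 * (2 ^ j * (P * W\<^sup>2))\<close>, because \<open>j + W \<le> 2 ^ j * W\<close>. The
  threshold yields 8 times the same quantity on the left, and the difference absorbs the prefactors
  since \<open>W \<ge> 23\<close>.\<close>

lemma theta_tail_le:
  fixes Q :: real
  assumes g: "g \<ge> 1" and Q: "Q = hkz_factor g"
  shows "exp (real g / 2) * (4 * (real g ^ 3 * Q)) ^ g *
      exp (- (2 ^ j) * (16 * (real g ^ 4 * Q) * (weight_exponent g)\<^sup>2) / 2)
     \<le> (arc_weight g j / 4) ^ (g * box_degree g) / 4"
proof -
  define P where "P = real g ^ 4 * Q"
  define W where "W = weight_exponent g"
  define S where "S = real (g * box_degree g)"
  have W: "23 \<le> W" using weight_exponent_ge[OF g] by (simp add: W_def)
  have Q1: "1 \<le> Q" using hkz_factor_ge_1[OF g] by (simp add: Q)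
  have "real g \<le> real g ^ 4 * 1" using g power_increasing[of 1 4 "real g"] by simp
  also have "\<dots> \<le> P" unfolding P_def using Q1 by (intro mult_left_mono) auto
  finally have gP: "real g \<le> P" .
  then have P1: "1 \<le> P" using g by simp
  have S: "S \<le> 8 * P * W"
    using box_degree_le[OF g] by (simp add: S_def P_def W_def Q)
  have Z: "4 * (real g ^ 3 * Q) > 0" using Q1 g by simp
  have "(4 * (real g ^ 3 * Q)) ^ g = exp (g * ln (4 * (real g ^ 3 * Q)))"
    using Z by (simp add: exp_of_nat_mult)
  also have "\<dots> \<le> exp (g * (4 * (real g ^ 3 * Q)))"
    using ln_le_minus_one[OF Z] by (intro exp_mono mult_left_mono) auto
  also have "g * (4 * (real g ^ 3 * Q)) = 4 * P"
    by (simp add: P_def power4_eq_xxxx power3_eq_cube)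
  finally have pw: "(4 * (real g ^ 3 * Q)) ^ g \<le> exp (4 * P)" .
  have four: "(4::real) \<le> exp 2"
    using exp_ge_one_plus_x_over_n_power_n[of 2 "2::real"] by simp
  have j: "1 + real j \<le> 2 ^ j" by (induction j) auto
  have "4 * (exp (real g / 2) * (4 * (real g ^ 3 * Q)) ^ g * exp (- (2 ^ j) * (16 * P * W\<^sup>2) / 2))
     \<le> exp 2 * (exp (real g / 2) * exp (4 * P) * exp (- (2 ^ j) * (16 * P * W\<^sup>2) / 2))"
    using four pw Q1 by (intro mult_mono mult_nonneg_nonneg) auto
  also have "\<dots> = exp (2 + real g / 2 + 4 * P + - (2 ^ j) * (16 * P * W\<^sup>2) / 2)"
    by (simp only: exp_add mult_ac)
  also have "\<dots> \<le> exp (- (S * (ln 2 * (real j + W))))"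
  proof -
    have "real j + W \<le> 2 ^ j * W"
    proof -
      have "1 * (W - 1) \<le> 2 ^ j * (W - 1)" using W by (intro mult_right_mono) auto
      then show ?thesis using j by (simp add: algebra_simps)
    qed
    then have A: "ln 2 * (real j + W) \<le> 25/36 * (2 ^ j * W)"
      using ln2_le_25_over_36 W by (intro mult_mono) auto
    have "S * (ln 2 * (real j + W)) \<le> 8 * P * W * (25/36 * (2 ^ j * W))"
      using P1 W by (intro mult_mono[OF S A]) auto
    also have "\<dots> = 50/9 * (2 ^ j * (P * W\<^sup>2))" by (simp add: power2_eq_square)
    finally have 1: "S * (ln 2 * (real j + W)) \<le> 50/9 * (2 ^ j * (P * W\<^sup>2))" .
    have "1 * (P * 23\<^sup>2) \<le> 2 ^ j * (P * W\<^sup>2)"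
      using W P1 by (intro mult_mono power_mono) auto
    then have "529 * P \<le> 2 ^ j * (P * W\<^sup>2)" by simp
    with 1 have "2 + real g / 2 + 4 * P + S * (ln 2 * (real j + W)) \<le> 8 * (2 ^ j * (P * W\<^sup>2))"
      using gP P1 by linarith
    then show ?thesis by (simp add: algebra_simps)
  qed
  also have "\<dots> = (arc_weight g j / 4) ^ (g * box_degree g)"
    by (simp add: arc_weight_power S_def W_def)
  finally show ?thesis by (simp add: P_def W_def)
qed

text \<open>The exponent 25 L splits into 20 L for \<open>g * box_degree g\<close> and 5 L for the
  weight exponent, which is at most 9 p. A factor h accounts for the level j, and
  \<open>ln (1 + h) \<ge> ln 2\<close> for base two. The ratio 9/24 leaves room for the division by
  4.\<close>

lemma eta_le_arc_weight_power:
  assumes g: "g \<ge> 1" and jh: "j < h" and \<eta>: "\<eta> > 0"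
    and ln_\<eta>: "ln (1 / \<eta>) = 2 powr (25 * log_exponent g) * (real h)\<^sup>2 * ln (1 + real h)"
  shows "\<eta> \<le> (arc_weight g j / 4) ^ (g * box_degree g) / 4"
proof -
  define L where "L = log_exponent g"
  define W where "W = weight_exponent g"
  define S where "S = real (g * box_degree g)"
  define p where "p = (2::real) powr (5 * L)"
  have ln2: "2/3 \<le> ln (2::real)" by (rule ln2_ge_two_thirds)
  have L1: "1 \<le> L" by (simp add: L_def log_exponent_def)
  have p: "3 * L + 1 \<le> p"
  proof -
    have "1 + 5 * L * ln 2 \<le> p"
      unfolding p_def powr_def by simp
    moreover have "5 * L * (2/3) \<le> 5 * L * ln 2" using ln2 L1 by (intro mult_left_mono) auto
    ultimately show ?thesis using L1 by linarith
  qed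
  have gp: "real g \<le> p"
  proof -
    define x where "x = ln (real g)"
    have "0 \<le> (x - 1)\<^sup>2" by simp
    then have "x \<le> L"
      by (simp add: L_def log_exponent_def x_def[symmetric] power2_eq_square algebra_simps)
        (use zero_le_square[of x] in linarith)
    moreover have "5 * L * (2/3) \<le> 5 * L * ln 2" using ln2 L1 by (intro mult_left_mono) auto
    ultimately have "x \<le> 5 * L * ln 2" using L1 by linarith
    then have "exp x \<le> p" by (simp add: p_def powr_def)
    then show ?thesis using g by (simp add: x_def)
  qed
  have W: "W \<le> 9 * p"
    using p gp L1 by (simp add: W_def weight_exponent_def L_def[symmetric])
  have W23: "23 \<le> W" using weight_exponent_ge[OF g] by (simp add: W_def)
  have S: "S \<le> 2 powr (20 * L) / 24"
    unfolding S_def L_def by (rule box_degree_le_powr[OF g])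
  have h1: "1 \<le> real h" using jh by simp
  have "S * (real j + W) \<le> (2 powr (20 * L) / 24) * (real h * (9 * p))"
  proof (rule mult_mono[OF S])
    have "real j + W \<le> real h - 1 + W" using jh by simp
    also have "\<dots> \<le> real h * W"
    proof -
      have "(real h - 1) * 1 \<le> (real h - 1) * W" using h1 W23 by (intro mult_left_mono) auto
      then show ?thesis by (simp add: algebra_simps)
    qed
    also have "\<dots> \<le> real h * (9 * p)" using W by (intro mult_left_mono) auto
    finally show "real j + W \<le> real h * (9 * p)" .
  qed (use W23 in auto)
  also have "\<dots> = 9/24 * real h * (2 powr (20 * L) * p)" by simp
  also have "2 powr (20 * L) * p = 2 powr (25 * L)"
    by (simp add: p_def flip: powr_add)
  finally have 1: "S * (real j + W) \<le> 9/24 * (2 powr (25 * L) * real h)"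
    by (simp add: mult_ac)
  have "(2::real) powr 2 \<le> 2 powr (25 * L)"
    using L1 by (intro powr_mono) auto
  then have "4 * 1 \<le> 2 powr (25 * L) * real h"
    using h1 by (intro mult_mono) auto
  with 1 have "S * (real j + W) + 2 \<le> 2 powr (25 * L) * real h" by linarith
  also have "\<dots> \<le> 2 powr (25 * L) * (real h)\<^sup>2"
    using h1 by (intro mult_left_mono self_le_power) auto
  finally have "ln 2 * (S * (real j + W) + 2) \<le> ln (1 + real h) * (2 powr (25 * L) * (real h)\<^sup>2)"
    using h1 W23 by (intro mult_mono) (auto simp: S_def)
  then have "ln 2 * (S * (real j + W)) + 2 * ln 2 \<le> ln (1 / \<eta>)"
    by (simp add: ln_\<eta> L_def algebra_simps)
  then have "ln \<eta> + 2 * ln 2 \<le> - (S * (ln 2 * (real j + W)))"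
    using \<eta> by (simp add: ln_div algebra_simps)
  then have "exp (ln \<eta> + 2 * ln 2) \<le> exp (- (S * (ln 2 * (real j + W))))" by simp
  moreover have "exp (ln \<eta> + 2 * ln 2) = \<eta> * 4"
    using \<eta> exp_of_nat_mult[of 2 "ln 2 :: real"] by (simp add: exp_add)
  ultimately show ?thesis
    by (simp add: arc_weight_power S_def W_def)
qed

text \<open>The series is treated with E the excess of the squared norm, A the Gaussian factor and
  frequency \<open>c * 2 ^ j\<close>. The level enters through the scale, the frequency and the arc
  weight, so box and degree are the same at all levels; c = 1 and c = 2 stand for translation by t
  and by 2t.\<close>

lemma card_small_theta_tilde:
  fixes z :: "(complex, 'g::{finite,linorder}) vec" and \<tau> :: "((complex, 'g) vec, 'g) vec"
    and a b v :: "(real, 'g) vec" and j c D :: nat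
  assumes red: "reduced_matrix \<tau>" and v: "v = - (matrix_inv (Im_mat \<tau>) *v Im_vec z)"
    and D: "D > 0" and q: "c * 2 ^ j dvd D"
  shows "real (card {t \<in> grid D.
      norm (theta_tilde a b (2 ^ j *\<^sub>R (z + real c *\<^sub>R cvec t)) (2 ^ j *\<^sub>R \<tau>))
        < exp (- (2 ^ j) * (dist_tau \<tau> v (half_shift a))\<^sup>2) *
          ((arc_weight CARD('g) j / 4) ^ (CARD('g) * box_degree CARD('g)) / 4)})
    \<le> CARD('g) * box_degree CARD('g) * (arc_weight CARD('g) j + c * 2 ^ j / D) * D ^ CARD('g)"
proof -
  define g where "g = CARD('g)"
  define Q where "Q = hkz_factor g"
  define W where "W = weight_exponent g"
  define dd where "dd = dist_tau \<tau> v (half_shift a)"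
  have g: "g \<ge> 1" by (simp add: g_def Suc_le_eq)
  have \<tau>: "\<tau> \<in> siegel" using red by (simp add: reduced_matrix_def)
  have Q1: "1 \<le> Q" unfolding Q_def by (rule hkz_factor_ge_1[OF g])
  have W: "23 \<le> W" unfolding W_def by (rule weight_exponent_ge[OF g])
  obtain C :: "('g \<Rightarrow> int) \<Rightarrow> complex"
    where C: "\<And>k. norm (C k) = exp (- (2 ^ j) * (norm_tau \<tau> (shift_vec a k - v))\<^sup>2)"
      and series: "\<And>u. norm (theta_tilde a b (2 ^ j *\<^sub>R (z + cvec u)) (2 ^ j *\<^sub>R \<tau>)) =
       norm (\<Sum>\<^sub>\<infinity>k. C k * cis (2 * pi * (2 ^ j * (\<Sum>i\<in>UNIV. k i * u $ i))))"
    using norm_theta_tilde_series[OF \<tau> _ v, where s = "2 ^ j" and a = a and b = b] by auto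
  define E where "E k = (norm_tau \<tau> (shift_vec a k - v))\<^sup>2 - dd\<^sup>2" for k
  define \<xi> where "\<xi> i = v $ i - a $ i / 2" for i
  have hs: "shift_vec a k \<in> half_shift a" for k
    using bij_shift_vec[of a] by (auto simp: bij_betw_def)
  have E0: "0 \<le> E k" for k
    using dist_tau_half_shift(2)[OF \<tau> hs] by (simp add: E_def dd_def)
  have coord: "(k i - \<xi> i)\<^sup>2 \<le> (real g)\<^sup>2 * Q * (g / 4 + 3/8 * E k)" for k i
    using coordinate_le_excess[OF red hs[of k], of i v]
    by (simp add: E_def dd_def \<xi>_def g_def Q_def shift_vec_def algebra_simps)
  define r where "r = 16 * (real g ^ 4 * Q) * W\<^sup>2"
  have big: "real g * 1 * 1 \<le> real g ^ 4 * Q * W\<^sup>2"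
  proof (intro mult_mono)
    show "real g \<le> real g ^ 4" using g power_increasing[of 1 4 "real g"] by simp
    show "1 \<le> W\<^sup>2" using W by (intro one_le_power) auto
  qed (use Q1 in auto)
  have r: "real g \<le> r" "1 \<le> r" using big g by (auto simp: r_def)
  have near: "\<exists>k. 2 ^ j * E k \<le> ln 2"
  proof -
    obtain n where n: "n \<in> half_shift a" "(norm_tau \<tau> (n - v))\<^sup>2 < dd\<^sup>2 + ln 2 / 2 ^ j"
      using dist_tau_half_shift(3)[OF \<tau>, of "ln 2 / 2 ^ j" a v] unfolding dd_def by auto
    then obtain k where "n = shift_vec a k"
      using bij_shift_vec[of a] by (metis bij_betw_imp_surj_on imageE)
    then have "E k \<le> ln 2 / 2 ^ j" using n(2) by (simp add: E_def)
    then show ?thesis by (auto simp: field_simps)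
  qed
  have rad: "0 \<le> box_radius g" "(box_radius g)\<^sup>2 = (real g)\<^sup>2 * Q * r"
    using Q1 W by (auto simp: box_radius_def Q_def W_def r_def power2_eq_square power3_eq_cube power4_eq_xxxx)
  have "real (card {f \<in> UNIV \<rightarrow>\<^sub>E {..<D}.
      norm (\<Sum>\<^sub>\<infinity>k. C k * cis (2 * pi * (real (c * 2 ^ j) * (\<Sum>i\<in>UNIV. k i * real (f i)) / D)))
        < exp (- (2 ^ j) * dd\<^sup>2) * ((arc_weight g j / 4) ^ (CARD('g) * box_degree g) / 4)})
     \<le> CARD('g) * box_degree g * (arc_weight g j + real (c * 2 ^ j) / D) * D ^ CARD('g)"
  proof (rule card_small_theta_sum)
    show "norm (C k) = exp (- (2 ^ j) * dd\<^sup>2) * exp (- (2 ^ j) * E k)" for k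
      unfolding C E_def by (simp add: right_diff_distrib flip: exp_add)
    show "\<bar>k i - \<xi> i\<bar> \<le> box_radius g" if "E k \<le> r" for k i
    proof -
      have "(k i - \<xi> i)\<^sup>2 \<le> (real g)\<^sup>2 * Q * (g / 4 + 3/8 * E k)" by (rule coord)
      also have "\<dots> \<le> (real g)\<^sup>2 * Q * r"
        using that r Q1 by (intro mult_left_mono) auto
      finally have "\<bar>k i - \<xi> i\<bar>\<^sup>2 \<le> (box_radius g)\<^sup>2" by (simp add: rad)
      then show ?thesis by (rule power2_le_imp_le) (rule rad(1))
    qed
    show "box_degree g = nat \<lfloor>2 * box_radius g\<rfloor>" by (rule box_degree_def)
    show "(\<Sum>k\<in>F. exp (- (E k / 2))) \<le> exp (real g / 2) * (4 * (real g ^ 3 * Q)) ^ g" if "finite F" for F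
    proof -
      \<comment> \<open>Normalises the coordinate bound summed over g coordinates. Its coefficient
        3/8 lies below 1/2, so \<open>E k / 2\<close> dominates the resulting Gaussian.\<close>
      define \<beta> where "\<beta> = 1 / (real g ^ 3 * Q)"
      have "1 * 1 \<le> real g ^ 3 * Q" using g Q1 by (intro mult_mono) auto
      then have \<beta>: "0 < \<beta>" "\<beta> \<le> 1" by (auto simp: \<beta>_def)
      have "\<beta> * (\<Sum>i\<in>UNIV. (k i - \<xi> i)\<^sup>2) \<le> E k / 2 + g / 2" for k
      proof -
        have "\<beta> * (\<Sum>i\<in>UNIV. (k i - \<xi> i)\<^sup>2) \<le> \<beta> * (\<Sum>i\<in>(UNIV::'g set). (real g)\<^sup>2 * Q * (g / 4 + 3/8 * E k))"
          using \<beta> by (intro mult_left_mono sum_mono coord) auto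
        also have "\<dots> = \<beta> * (real g ^ 3 * Q) * (g / 4 + 3/8 * E k)"
          by (simp add: g_def power2_eq_square power3_eq_cube)
        also have "\<dots> = g / 4 + 3/8 * E k"
          using g Q1 by (simp add: \<beta>_def)
        also have "\<dots> \<le> E k / 2 + g / 2" using E0[of k] by simp
        finally show ?thesis .
      qed
      from sum_exp_neg_quadratic_le[OF that \<beta> this]
      show ?thesis by (simp add: \<beta>_def g_def)
    qed
    show "exp (real g / 2) * (4 * (real g ^ 3 * Q)) ^ g * exp (- (2 ^ j) * r / 2)
        \<le> (arc_weight g j / 4) ^ (CARD('g) * box_degree g) / 4"
      using theta_tail_le[OF g Q_def, of j] by (simp add: r_def W_def g_def)
  qed (use E0 near r D q arc_weight_bounds[OF g] in auto)
  moreover have "card {t \<in> grid D.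
      norm (theta_tilde a b (2 ^ j *\<^sub>R (z + real c *\<^sub>R cvec t)) (2 ^ j *\<^sub>R \<tau>))
        < exp (- (2 ^ j) * dd\<^sup>2) * ((arc_weight g j / 4) ^ (CARD('g) * box_degree g) / 4)}
    = card {f \<in> UNIV \<rightarrow>\<^sub>E {..<D}.
      norm (\<Sum>\<^sub>\<infinity>k. C k * cis (2 * pi * (real (c * 2 ^ j) * (\<Sum>i\<in>UNIV. k i * real (f i)) / D)))
        < exp (- (2 ^ j) * dd\<^sup>2) * ((arc_weight g j / 4) ^ (CARD('g) * box_degree g) / 4)}"
    (is "card {t \<in> grid D. ?P t} = card {f \<in> _. ?R f}")
  proof -
    have PR: "?P (grid_point D f) \<longleftrightarrow> ?R f" for f :: "'g \<Rightarrow> nat"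
    proof -
      have "real c *\<^sub>R cvec (grid_point D f) = cvec (real c *\<^sub>R grid_point D f)"
        by (simp add: vec_eq_iff cvec_def complex_eq_iff)
      moreover have "2 ^ j * (\<Sum>i\<in>UNIV. k i * (real c *\<^sub>R grid_point D f) $ i)
         = real (c * 2 ^ j) * (\<Sum>i\<in>UNIV. k i * real (f i)) / D" for k :: "'g \<Rightarrow> int"
        by (simp add: grid_point_def sum_distrib_left sum_divide_distrib mult_ac)
      ultimately show ?thesis by (simp only: series)
    qed
    show ?thesis
      by (rule card_Collect_bij_betw[where P = ?P and R = ?R, OF bij_grid_point[OF D]]) (rule PR)
  qed
  ultimately show ?thesis by (simp add: g_def dd_def)
qed

section \<open>Union bound over levels and characteristics\<close>

lemma theta_tilde_real_argument: "Im_vec w = 0 \<Longrightarrow> theta_tilde a b w \<tau> = theta a b w \<tau>"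
  by (simp add: theta_tilde_def)

lemma Im_vec_scaleR_cvec: "Im_vec (x *\<^sub>R cvec t) = 0"
  by (simp add: Im_vec_def cvec_def vec_eq_iff)

lemma char_vecs_card:
  shows "finite (char_vecs :: (real ^ 'g) set)" "card (char_vecs :: (real ^ 'g) set) \<le> 2 ^ CARD('g)"
proof -
  define supp where "supp a = {i. a $ i = 1}" for a :: "real ^ 'g"
  have inj: "inj_on supp char_vecs"
  proof (rule inj_onI)
    fix a a' assume "a \<in> char_vecs" "a' \<in> char_vecs" "supp a = supp a'"
    then have "a $ i = a' $ i" for i
      by (auto simp: char_vecs_def supp_def set_eq_iff) (metis zero_neq_one)
    then show "a = a'" by (simp add: vec_eq_iff)
  qed
  show "finite (char_vecs :: (real ^ 'g) set)"
    by (rule inj_on_finite[OF inj, of "Pow UNIV"]) auto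
  show "card (char_vecs :: (real ^ 'g) set) \<le> 2 ^ CARD('g)"
    using card_inj_on_le[OF inj, of "Pow UNIV"] by (simp add: card_Pow)
qed

lemma sum_arc_weight_le: "(\<Sum>j\<in>{1..<h}. arc_weight g j) \<le> arc_weight g 0"
proof -
  have geometric: "arc_weight g j = arc_weight g 0 * (1/2) ^ j" for j
    by (simp add: arc_weight_def powr_diff powr_add powr_realpow power_one_over field_simps)
  have "(\<Sum>j\<in>{1..<h}. arc_weight g j) = (\<Sum>j\<in>{1..<h}. arc_weight g 0 * (1/2) ^ j)"
    by (intro sum.cong refl geometric)
  also have "\<dots> = arc_weight g 0 * (\<Sum>j\<in>{1..<h}. (1/2) ^ j)"
    by (simp only: sum_distrib_left)
  also have "(\<Sum>j\<in>{1..<h}. (1/2) ^ j) \<le> (1::real)"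
  proof (cases h)
    case (Suc n)
    have "(\<Sum>j\<in>{1..<Suc n}. (1/2) ^ j) = 1 - (1/2::real) ^ n"
      by (induction n) auto
    then show ?thesis using Suc by simp
  qed simp
  finally show ?thesis by (simp add: arc_weight_def mult_left_le)
qed

theorem theorem4p18:
  fixes z :: "(complex, 'g::{finite,linorder}) vec" and \<tau> :: "((complex, 'g) vec, 'g) vec"
    and h D :: nat and \<eta> L :: real and v :: "(real, 'g) vec"
  assumes "reduced_point z \<tau>" and "h \<ge> 1"
    and "L = 1 + (ln (real CARD('g)))\<^sup>2"
    and "\<eta> > 0" and "ln (1 / \<eta>) = 2 powr (25 * L) * (real h)\<^sup>2 * ln (1 + real h)"
    and "\<exists>k. D = 2 ^ k"
    and "real D \<ge> 2 powr (20 * L) * (2 ^ (2 * CARD('g)) + 2 ^ (CARD('g) + h))"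
    and "v = - (matrix_inv (Im_mat \<tau>) *v Im_vec z)"
  shows "2 * card {t \<in> grid D.
     (\<forall>j a. 1 \<le> j \<and> j \<le> h - 1 \<and> a \<in> char_vecs \<longrightarrow>
        norm (theta a 0 (2 ^ j *\<^sub>R cvec t) (2 ^ j *\<^sub>R \<tau>))
          \<ge> \<eta> * exp (- (2 ^ j) * (dist_tau \<tau> 0 (half_shift a))\<^sup>2) \<and>
        norm (theta a 0 (2 ^ (j + 1) *\<^sub>R cvec t) (2 ^ j *\<^sub>R \<tau>))
          \<ge> \<eta> * exp (- (2 ^ j) * (dist_tau \<tau> 0 (half_shift a))\<^sup>2) \<and>
        norm (theta_tilde a 0 (2 ^ j *\<^sub>R (z + cvec t)) (2 ^ j *\<^sub>R \<tau>))
          \<ge> \<eta> * exp (- (2 ^ j) * (dist_tau \<tau> v (half_shift a))\<^sup>2) \<and>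
        norm (theta_tilde a 0 (2 ^ j *\<^sub>R (z + 2 *\<^sub>R cvec t)) (2 ^ j *\<^sub>R \<tau>))
          \<ge> \<eta> * exp (- (2 ^ j) * (dist_tau \<tau> v (half_shift a))\<^sup>2)) \<and>
     (\<forall>a\<in>char_vecs. \<forall>b\<in>char_vecs.
        norm (theta_tilde a b (z + 2 *\<^sub>R cvec t) \<tau>)
          \<ge> \<eta> * exp (- (dist_tau \<tau> v (half_shift a))\<^sup>2))}
     \<ge> card (grid D :: (real, 'g) vec set)"
    (is "2 * card ?G \<ge> _")
proof -
  define g where "g = CARD('g)"
  define S where "S = g * box_degree g"
  have g: "g \<ge> 1" by (simp add: g_def Suc_le_eq)
  have L: "L = log_exponent g" using assms(3) by (simp add: log_exponent_def g_def)
  have red: "reduced_matrix \<tau>" using assms(1) by (simp add: reduced_point_def)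
  obtain e where De: "D = 2 ^ e" using assms(6) by blast
  have D0: "D > 0" by (simp add: De)
  define X where "X = (2::real) powr (20 * L)"
  have X1: "1 \<le> X"
    by (simp add: X_def L log_exponent_def ge_one_powr_ge_zero)
  have D_ge: "X * (2 ^ (2 * g) + 2 ^ (g + h)) \<le> D" using assms(7) by (simp add: X_def g_def)
  have "1 * (2 ^ (g + h)) \<le> X * (2 ^ (2 * g) + 2 ^ (g + h))"
    using X1 by (intro mult_mono) auto
  from order_trans[OF this D_ge] have "(2::real) ^ (g + h) \<le> 2 ^ e" by (simp add: De)
  then have e: "g + h \<le> e" by simp
  have dvd: "1 * 2 ^ j dvd D" "2 * 2 ^ j dvd D" if "j < h" for j
    unfolding De using that e g by (auto simp: le_imp_power_dvd simp flip: power_Suc)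
  define \<kappa> where "\<kappa> j = (arc_weight g j / 4) ^ S / 4" for j
  have \<eta>\<kappa>: "\<eta> \<le> \<kappa> j" if "j < h" for j
    unfolding \<kappa>_def S_def using assms(5) by (intro eta_le_arc_weight_power[OF g that assms(4)]) (simp add: L)
  \<comment> \<open>With w = 0 and centre 0 this also covers the inequalities for
    \<open>theta\<close>: at a real argument the factor in front of \<open>theta_tilde\<close> is
    1.\<close>
  define B where "B w c v' j a b = {t \<in> grid D.
      norm (theta_tilde a b (2 ^ j *\<^sub>R (w + real c *\<^sub>R cvec t)) (2 ^ j *\<^sub>R \<tau>))
        < exp (- (2 ^ j) * (dist_tau \<tau> v' (half_shift a))\<^sup>2) * \<kappa> j}"
    for w c v' j and a b :: "(real, 'g) vec"
  have finB: "finite (B w c v' j a b)" for w c v' j a b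
    using finite_grid[OF D0, where ?'g = 'g] by (simp add: B_def)
  have cardB: "real (card (B w c v' j a b)) \<le> S * (arc_weight g j + c * 2 ^ j / D) * D ^ g"
    if "v' = - (matrix_inv (Im_mat \<tau>) *v Im_vec w)" "c * 2 ^ j dvd D" for w c v' j a b
    unfolding B_def \<kappa>_def S_def g_def
    using card_small_theta_tilde[OF red that(1) D0 that(2), of a b]
    by (simp only: of_nat_mult of_nat_power of_nat_numeral)
  have v0: "(0 :: (real, 'g) vec) = - (matrix_inv (Im_mat \<tau>) *v Im_vec 0)"
  proof -
    have "Im_vec 0 = (0 :: (real, 'g) vec)" by (simp add: Im_vec_def vec_eq_iff)
    then show ?thesis by simp
  qed
  have notB: "\<eta> * exp (- (2 ^ j) * (dist_tau \<tau> v' (half_shift a))\<^sup>2)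
      \<le> norm (theta_tilde a b (2 ^ j *\<^sub>R (w + real c *\<^sub>R cvec t)) (2 ^ j *\<^sub>R \<tau>))"
    if "t \<in> grid D" "t \<notin> B w c v' j a b" "j < h" for t w c v' j a b
  proof -
    define E where "E = exp (- (2 ^ j) * (dist_tau \<tau> v' (half_shift a))\<^sup>2)"
    have "\<eta> * E \<le> \<kappa> j * E"
      using \<eta>\<kappa>[OF that(3)] by (intro mult_right_mono) (auto simp: E_def)
    also have "\<kappa> j * E \<le> norm (theta_tilde a b (2 ^ j *\<^sub>R (w + real c *\<^sub>R cvec t)) (2 ^ j *\<^sub>R \<tau>))"
      using that(1,2) unfolding B_def E_def[symmetric] mem_Collect_eq mult.commute[of E] not_le[symmetric] by blast
    finally show ?thesis by (simp only: E_def)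
  qed
  define U1 where "U1 j a = (B 0 1 0 j a 0 \<union> B 0 2 0 j a 0) \<union> (B z 1 v j a 0 \<union> B z 2 v j a 0)" for j a
  define U where "U = (\<Union>j\<in>{1..<h}. \<Union>a\<in>char_vecs. U1 j a)"
  \<comment> \<open>The inequalities involving b are level 0 with c = 2; \<open>h \<ge> 1\<close>
    makes level 0 admissible in the bound for \<eta>.\<close>
  define V where "V = (\<Union>a\<in>char_vecs. \<Union>b\<in>char_vecs. B z 2 v 0 a b)"
  have "grid D \<subseteq> ?G \<union> (U \<union> V)"
  proof
    fix t :: "(real, 'g) vec" assume t: "t \<in> grid D"
    show "t \<in> ?G \<union> (U \<union> V)"
    proof (cases "t \<in> U \<union> V")
      case False
      have 1: "\<eta> * exp (- (2 ^ j) * (dist_tau \<tau> 0 (half_shift a))\<^sup>2)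
            \<le> norm (theta a 0 (2 ^ j *\<^sub>R cvec t) (2 ^ j *\<^sub>R \<tau>)) \<and>
          \<eta> * exp (- (2 ^ j) * (dist_tau \<tau> 0 (half_shift a))\<^sup>2)
            \<le> norm (theta a 0 (2 ^ (j + 1) *\<^sub>R cvec t) (2 ^ j *\<^sub>R \<tau>)) \<and>
          \<eta> * exp (- (2 ^ j) * (dist_tau \<tau> v (half_shift a))\<^sup>2)
            \<le> norm (theta_tilde a 0 (2 ^ j *\<^sub>R (z + cvec t)) (2 ^ j *\<^sub>R \<tau>)) \<and>
          \<eta> * exp (- (2 ^ j) * (dist_tau \<tau> v (half_shift a))\<^sup>2)
            \<le> norm (theta_tilde a 0 (2 ^ j *\<^sub>R (z + 2 *\<^sub>R cvec t)) (2 ^ j *\<^sub>R \<tau>))"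
        if "1 \<le> j" "j \<le> h - 1" "a \<in> char_vecs" for j a
      proof -
        have jh: "j < h" using that assms(2) by simp
        then have "t \<notin> U1 j a" using False that by (auto simp: U_def)
        then have "t \<notin> B 0 1 0 j a 0" "t \<notin> B 0 2 0 j a 0" "t \<notin> B z 1 v j a 0" "t \<notin> B z 2 v j a 0"
          by (auto simp: U1_def)
        from this[THEN notB[OF t _ jh]] show ?thesis
          by (simp add: theta_tilde_real_argument Im_vec_scaleR_cvec mult.commute)
      qed
      have 2: "\<eta> * exp (- (dist_tau \<tau> v (half_shift a))\<^sup>2) \<le> norm (theta_tilde a b (z + 2 *\<^sub>R cvec t) \<tau>)"
        if "a \<in> char_vecs" "b \<in> char_vecs" for a b
      proof -
        have "t \<notin> B z 2 v 0 a b" using False that by (auto simp: V_def)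
        from notB[OF t this] show ?thesis using assms(2) by simp
      qed
      show ?thesis using t 1 2 by simp
    qed simp
  qed
  moreover have fin: "finite ?G" "finite U" "finite V"
    using finite_grid[OF D0] finB char_vecs_card(1) by (auto simp: U_def U1_def V_def)
  ultimately have "card (grid D :: (real, 'g) vec set) \<le> card (?G \<union> (U \<union> V))"
    by (intro card_mono) auto
  also have "\<dots> \<le> card ?G + (card U + card V)"
    by (meson add_left_mono card_Un_le order_trans)
  finally have *: "card (grid D :: (real, 'g) vec set) \<le> card ?G + (card U + card V)" .
  define N where "N = card ?G"
  have card_grid_g: "card (grid D :: (real, 'g) vec set) = D ^ g"
    by (simp add: card_grid[OF D0] g_def)
  from * have total: "D ^ g \<le> N + (card U + card V)"
    unfolding card_grid_g N_def .
  define p where "p = S * real (D ^ g)"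
  have p0: "0 \<le> p" by (simp add: p_def)
  have U1: "real (card (U1 j a)) \<le> p * (4 * arc_weight g j + 6 * 2 ^ j / D)" if "j < h" for j a
  proof -
    have "card (U1 j a) \<le> (card (B 0 1 0 j a 0) + card (B 0 2 0 j a 0)) + (card (B z 1 v j a 0) + card (B z 2 v j a 0))"
      unfolding U1_def by (intro order_trans[OF card_Un_le] add_mono card_Un_le)
    then have "real (card (U1 j a)) \<le> real (card (B 0 1 0 j a 0)) + real (card (B 0 2 0 j a 0))
        + (real (card (B z 1 v j a 0)) + real (card (B z 2 v j a 0)))"
      by linarith
    also have "\<dots> \<le> S * (arc_weight g j + real 1 * 2 ^ j / D) * D ^ g + S * (arc_weight g j + real 2 * 2 ^ j / D) * D ^ g
        + (S * (arc_weight g j + real 1 * 2 ^ j / D) * D ^ g + S * (arc_weight g j + real 2 * 2 ^ j / D) * D ^ g)"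
      by (intro add_mono cardB v0 assms(8) dvd that)
    \<comment> \<open>The multipliers 1, 2, 1, 2 of the four functions add up to 6.\<close>
    also have "\<dots> = p * (4 * arc_weight g j + 6 * 2 ^ j / D)"
      by (simp add: p_def field_simps)
    finally show ?thesis .
  qed
  have w0: "0 \<le> arc_weight g j" for j by (simp add: arc_weight_def)
  have cc: "real (card (char_vecs :: (real, 'g) vec set)) \<le> 2 ^ g"
    using of_nat_mono[OF char_vecs_card(2)[where ?'g = 'g], where ?'a = real] by (simp add: g_def)
  have "real (card U) \<le> 2 ^ g * (p * (4 * arc_weight g 0 + 6 * 2 ^ h / D))"
  proof -
    have "card U \<le> (\<Sum>j\<in>{1..<h}. card (\<Union>a\<in>char_vecs. U1 j a))"
      unfolding U_def by (rule card_UN_le) simp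
    also have "\<dots> \<le> (\<Sum>j\<in>{1..<h}. \<Sum>a\<in>char_vecs. card (U1 j a))"
      by (intro sum_mono card_UN_le char_vecs_card)
    finally have "real (card U) \<le> (\<Sum>j\<in>{1..<h}. \<Sum>a\<in>(char_vecs :: (real, 'g) vec set). real (card (U1 j a)))"
      by (simp flip: of_nat_sum)
    also have "\<dots> \<le> (\<Sum>j\<in>{1..<h}. \<Sum>a\<in>(char_vecs :: (real, 'g) vec set). p * (4 * arc_weight g j + 6 * 2 ^ j / D))"
      by (intro sum_mono U1) simp
    also have "\<dots> \<le> (\<Sum>j\<in>{1..<h}. 2 ^ g * (p * (4 * arc_weight g j + 6 * 2 ^ j / D)))"
      unfolding sum_constant using p0 w0 by (intro sum_mono mult_right_mono cc) auto
    also have "\<dots> = 2 ^ g * (p * (4 * (\<Sum>j\<in>{1..<h}. arc_weight g j) + 6 * (\<Sum>j\<in>{1..<h}. 2 ^ j) / D))"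
      by (simp add: sum_distrib_left sum.distrib sum_divide_distrib distrib_left)
    also have "\<dots> \<le> 2 ^ g * (p * (4 * arc_weight g 0 + 6 * 2 ^ h / D))"
    proof -
      have "(\<Sum>j\<in>{1..<h}. 2 ^ j) \<le> (2::real) ^ h"
        by (induction h) (auto simp: atLeastLessThanSuc)
      then show ?thesis using p0 sum_arc_weight_le[where g = g and h = h]
        by (intro mult_left_mono add_mono divide_right_mono) auto
    qed
    finally show ?thesis .
  qed
  moreover have "real (card V) \<le> 2 ^ g * (2 ^ g * (p * (arc_weight g 0 + 2 / D)))"
  proof -
    have "card V \<le> (\<Sum>a\<in>char_vecs. card (\<Union>b\<in>char_vecs. B z 2 v 0 a b))"
      unfolding V_def by (intro card_UN_le char_vecs_card)
    also have "\<dots> \<le> (\<Sum>a\<in>char_vecs. \<Sum>b\<in>char_vecs. card (B z 2 v 0 a b))"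
      by (intro sum_mono card_UN_le char_vecs_card)
    finally have "real (card V) \<le> (\<Sum>a\<in>(char_vecs :: (real, 'g) vec set). \<Sum>b\<in>(char_vecs :: (real, 'g) vec set). real (card (B z 2 v 0 a b)))"
      by (simp flip: of_nat_sum)
    also have "\<dots> \<le> (\<Sum>a\<in>(char_vecs :: (real, 'g) vec set). \<Sum>b\<in>(char_vecs :: (real, 'g) vec set). p * (arc_weight g 0 + 2 / D))"
    proof (intro sum_mono)
      fix a b :: "(real, 'g) vec"
      show "real (card (B z 2 v 0 a b)) \<le> p * (arc_weight g 0 + 2 / D)"
        using cardB[OF assms(8) dvd(2), of 0 a b] assms(2) by (simp add: p_def mult_ac)
    qed
    also have "\<dots> \<le> 2 ^ g * (2 ^ g * (p * (arc_weight g 0 + 2 / D)))"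
      unfolding sum_constant using p0 w0 by (intro mult_mono cc mult_right_mono) auto
    finally show ?thesis .
  qed
  \<comment> \<open>The arcs contribute at most \<open>3 * 4 ^ g\<close> times the weight
    \<open>2 / (X * 4 ^ g)\<close>, which is 6 / X; the repeated values contribute another 6 / X by
    the size of D. Since \<open>S \<le> X / 24\<close>, at most half of the grid is lost.\<close>
  moreover have "2 ^ g * (p * (4 * arc_weight g 0 + 6 * 2 ^ h / D)) + 2 ^ g * (2 ^ g * (p * (arc_weight g 0 + 2 / D)))
      \<le> real (D ^ g) / 2"
  proof -
    have w: "arc_weight g 0 = 2 / (X * 4 ^ g)"
    proof -
      have "arc_weight g 0 = 2 powr (1 - 20 * L - 2 * real g)"
        by (simp add: arc_weight_def weight_exponent_def L algebra_simps)
      also have "\<dots> = 2 / (X * 2 powr (2 * real g))"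
        by (simp add: X_def powr_diff)
      finally show ?thesis
        using powr_realpow[of 2 "2 * g"] by (simp add: power_mult)
    qed
    have sq: "2 ^ g * 2 ^ g = (4::real) ^ g" using power_mult_distrib[of "2::real" 2 g] by simp
    have g2: "2 * 2 ^ g \<le> (4::real) ^ g"
    proof -
      have "(2::real) ^ 1 \<le> 2 ^ g" using g by (intro power_increasing) auto
      then have "2 * 2 ^ g \<le> 2 ^ g * (2::real) ^ g" by (intro mult_right_mono) auto
      then show ?thesis by (simp only: sq)
    qed
    have "2 ^ g * (4 * arc_weight g 0 + 6 * 2 ^ h / D) + 2 ^ g * (2 ^ g * (arc_weight g 0 + 2 / D))
       = (4 * 2 ^ g + 4 ^ g) * arc_weight g 0 + (6 * 2 ^ (g + h) + 2 * 4 ^ g) / D"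
      by (simp add: sq[symmetric] power_add add_divide_distrib algebra_simps)
    also have "\<dots> \<le> 6 / X + 6 / X"
    proof (rule add_mono)
      have "(4 * 2 ^ g + 4 ^ g) * arc_weight g 0 \<le> 3 * 4 ^ g * arc_weight g 0"
        using g2 w0[of 0] by (intro mult_right_mono) auto
      then show "(4 * 2 ^ g + 4 ^ g) * arc_weight g 0 \<le> 6 / X" by (simp add: w)
      define K where "K = (4::real) ^ g + 2 ^ (g + h)"
      have "X * K \<le> D" using D_ge by (simp add: K_def power_mult)
      then have "6 * K / D \<le> 6 / X" using X1 D0 by (simp add: field_simps)
      moreover have "(6 * 2 ^ (g + h) + 2 * 4 ^ g) / D \<le> 6 * K / D"
        by (intro divide_right_mono) (auto simp: K_def)
      ultimately show "(6 * 2 ^ (g + h) + 2 * 4 ^ g) / D \<le> 6 / X" by linarith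
    qed
    finally have "2 ^ g * (4 * arc_weight g 0 + 6 * 2 ^ h / D) + 2 ^ g * (2 ^ g * (arc_weight g 0 + 2 / D)) \<le> 12 / X"
      by simp
    then have "p * (2 ^ g * (4 * arc_weight g 0 + 6 * 2 ^ h / D) + 2 ^ g * (2 ^ g * (arc_weight g 0 + 2 / D))) \<le> p * (12 / X)"
      using p0 by (rule mult_left_mono)
    also have "\<dots> = S * (12 / X) * real (D ^ g)" by (simp add: p_def)
    also have "\<dots> \<le> (X / 24) * (12 / X) * real (D ^ g)"
      using box_degree_le_powr[OF g] X1 by (intro mult_right_mono) (auto simp: S_def X_def L)
    also have "\<dots> = real (D ^ g) / 2" using X1 by simp
    finally show ?thesis by (simp add: distrib_left mult_ac)
  qed
  moreover have "real (D ^ g) \<le> real N + (real (card U) + real (card V))"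
    using of_nat_mono[OF total, where ?'a = real] by simp
  ultimately have "real (D ^ g) \<le> 2 * real N" by linarith
  then have "real (D ^ g) \<le> real (2 * N)" by simp
  then have "D ^ g \<le> 2 * N" by (rule of_nat_le_iff[THEN iffD1])
  then show ?thesis unfolding card_grid_g N_def .
qed

end
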